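(* Let $p\ge 3$ and $d\ge 2$ be integers, let $n_1,\dots,n_{d-1}\ge 1$ be integers, $\sigma_1,\dots,\sigma_d>0$ fixed scales, and $\boldsymbol{x}\neq \boldsymbol{0}$ a fixed input vector. Let $\pi$ be the fixed-scale ReLU BNN prior density on $\mathbb{R}^p$ (defined in the context) and let $$\delta_{\mathrm{BNN,fixed}}(\boldsymbol{y})=\frac{\int_{\mathbb{R}^p}\boldsymbol{\theta}\,\phi_p(\boldsymbol{y}-\boldsymbol{\theta};\boldsymbol{0}_p,I_p)\,\pi(\boldsymbol{\theta})\,d\boldsymbol{\theta}}{\int_{\mathbb{R}^p}\phi_p(\boldsymbol{y}-\boldsymbol{\theta};\boldsymbol{0}_p,I_p)\,\pi(\boldsymbol{\theta})\,d\boldsymbol{\theta}}$$ be the induced Bayes decision rule (the posterior mean) in the model $\boldsymbol{Y}\mid\boldsymbol{\theta}\sim N_p(\boldsymbol{\theta},I_p)$ under quadratic loss. Then $\delta_{\mathrm{BNN,fixed}}$ is not minimax.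
   Context: $\phi_p(\cdot;\boldsymbol{\mu},\Sigma)$ denotes the $N_p(\boldsymbol{\mu},\Sigma)$ density. Decision problem: observe $\boldsymbol{Y}\mid\boldsymbol{\theta}\sim N_p(\boldsymbol{\theta},I_p)$ with unknown $\boldsymbol{\theta}\in\mathbb{R}^p$; loss $L(\boldsymbol{\theta},\boldsymbol{\delta})=\|\boldsymbol{\theta}-\boldsymbol{\delta}\|^2$ (Euclidean norm); risk $R(\boldsymbol{\theta},\boldsymbol{\delta})=\mathbb{E}_{\boldsymbol{\theta}}[\|\boldsymbol{\theta}-\boldsymbol{\delta}(\boldsymbol{Y})\|^2]$. A decision rule $\boldsymbol{\delta}_*$ is minimax if $\sup_{\boldsymbol{\theta}}R(\boldsymbol{\theta},\boldsymbol{\delta}_* )=\inf_{\boldsymbol{\delta}}\sup_{\boldsymbol{\theta}}R(\boldsymbol{\theta},\boldsymbol{\delta})$, the infimum being over all estimators. It is known that the minimax risk equals $p$. Fixed-scale ReLU BNN prior (continuous part of the output density of a depth-$d$ bias-free fully connected ReLU network with hidden widths $n_1,\dots,n_{d-1}$, output dimension $n_d=p$, and independent $N(0,\sigma_\ell^2)$ weights in layer $\ell$; the atom at $\boldsymbol{0}_p$ is discarded): for $\boldsymbol{\theta}\ne \boldsymbol{0}_p$, with $B=2^d\sigma_1^2\cdots\sigma_d^2\|\boldsymbol{x}\|^2$, $$\pi(\boldsymbol{\theta})=\frac{1}{2^{n_1+\dots+n_{d-1}}}\sum_{k_1=1}^{n_1}\cdots\sum_{k_{d-1}=1}^{n_{d-1}}\binom{n_1}{k_1}\cdots\binom{n_{d-1}}{k_{d-1}}\frac{\prod_{\ell=1}^{d-1}\Gamma(k_\ell/2)^{-1}}{(\pi_0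 B)^{p/2}}\;G^{d,0}_{0,d}\!\left(\frac{\|\boldsymbol{\theta}\|^2}{B}\;\Big|\;0,\tfrac{k_1-p}{2},\dots,\tfrac{k_{d-1}-p}{2}\right),$$ where $\pi_0=3.14159\ldots$ and $G^{d,0}_{0,d}$ is the Meijer G-function, $G^{d,0}_{0,d}(z\mid b_1,\dots,b_d)=\frac{1}{2\pi_0 i}\int_{c-i\infty}^{c+i\infty}\prod_{j=1}^d\Gamma(b_j+s)\,z^{-s}\,ds$ for $z>0$, with $c>\max_j(-b_j)$. This $\pi$ has finite total mass $\prod_{\ell=1}^{d-1}(2^{n_\ell}-1)/2^{n_1+\dots+n_{d-1}}$, not normalized to one; normalization does not affect the Bayes rule. *)

theory Defs
  imports "HOL-Probability.Probability"
begin

definition mvn_density :: "real^'p \<Rightarrow> real^'p^'p \<Rightarrow> real^'p \<Rightarrow> real" where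
  "mvn_density \<mu> \<Sigma> y =
     exp (- ((y - \<mu>) \<bullet> (matrix_inv \<Sigma> *v (y - \<mu>))) / 2) / sqrt ((2 * pi) ^ CARD('p) * det \<Sigma>)"

definition mvn :: "real^'p \<Rightarrow> real^'p^'p \<Rightarrow> (real^'p) measure" where
  "mvn \<mu> \<Sigma> = density lborel (\<lambda>y. ennreal (mvn_density \<mu> \<Sigma> y))"

text \<open>
  Risks take values in the extended nonnegative reals, so that an estimator of infinite risk
  is not confused with one of risk zero.
\<close>

definition risk :: "real^'p \<Rightarrow> (real^'p \<Rightarrow> real^'p) \<Rightarrow> ennreal" where
  "risk \<theta> \<delta> = (\<integral>\<^sup>+ y. ennreal ((norm (\<theta> - \<delta> y))\<^sup>2) \<partial>mvn \<theta> (mat 1))"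

text \<open>
  The estimators are the Borel measurable maps. Measurability of \<open>\<delta>\<close> itself is deliberately not
  a conjunct: a rule can fail to be minimax only through its risk.
\<close>

definition minimax :: "(real^'p \<Rightarrow> real^'p) \<Rightarrow> bool" where
  "minimax \<delta> \<longleftrightarrow>
     (SUP \<theta>. risk \<theta> \<delta>) = (INF \<delta>'\<in>(borel_measurable borel :: (real^'p \<Rightarrow> real^'p) set). SUP \<theta>. risk \<theta> \<delta>')"

text \<open>
  The Mellin--Barnes integral of the Meijer function \<open>G\<^bsup>d,0\<^esup>\<^bsub>0,d\<^esub>(z | b\<^sub>1, \<dots>, b\<^sub>d)\<close> along the line
  \<open>Re s = c\<close>, parametrised by \<open>s = c + \<i>t\<close>, \<open>ds = \<i> dt\<close>.
\<close>

definition mellin_barnes :: "real \<Rightarrow> real list \<Rightarrow> real \<Rightarrow> complex" where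
  "mellin_barnes c bs z =
     1 / (2 * of_real pi * \<i>) *
     (LINT t|lborel. (let s = Complex c t in
        (\<Prod>b\<leftarrow>bs. Gamma (of_real b + s)) * of_real z powr (- s) * \<i>))"

text \<open>
  The integral does not depend on the choice of \<open>c > max\<^sub>j (-b\<^sub>j)\<close>, and it is real for real
  parameters and \<open>z > 0\<close>.
\<close>

definition meijer_G :: "real list \<Rightarrow> real \<Rightarrow> real" where
  "meijer_G bs z = Re (mellin_barnes (SOME c. \<forall>b\<in>set bs. c > - b) bs z)"

definition bnn_scale :: "nat \<Rightarrow> (nat \<Rightarrow> real) \<Rightarrow> real^'m \<Rightarrow> real" where
  "bnn_scale d \<sigma> x = 2 ^ d * (\<Prod>l\<in>{1..d}. (\<sigma> l)\<^sup>2) * (norm x)\<^sup>2"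

text \<open>
  The layers are numbered \<open>1, \<dots>, d\<close>; \<open>n l\<close> is the width of hidden layer \<open>l \<in> {1..d-1}\<close>, \<open>\<sigma> l\<close> the
  weight scale of layer \<open>l\<close>, and the output dimension is \<open>CARD('p)\<close>. The density is specified off
  the origin only; the value there is immaterial because the origin is a null set.
\<close>

definition bnn_prior ::
    "nat \<Rightarrow> (nat \<Rightarrow> nat) \<Rightarrow> (nat \<Rightarrow> real) \<Rightarrow> real^'m \<Rightarrow> real^'p \<Rightarrow> real" where
  "bnn_prior d n \<sigma> x \<theta> =
     (if \<theta> = 0 then 0 else
      (let p = real CARD('p); B = bnn_scale d \<sigma> x in
       1 / 2 ^ (\<Sum>l\<in>{1..d-1}. n l) *
       (\<Sum>k\<in>(\<Pi>\<^sub>E l\<in>{1..d-1}. {1..n l}).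
          (\<Prod>l\<in>{1..d-1}. real (n l choose k l)) *
          ((\<Prod>l\<in>{1..d-1}. inverse (Gamma (real (k l) / 2))) / (pi * B) powr (p / 2)) *
          meijer_G (0 # map (\<lambda>l. (real (k l) - p) / 2) [1..<d]) ((norm \<theta>)\<^sup>2 / B))))"

definition posterior_mean :: "(real^'p \<Rightarrow> real) \<Rightarrow> real^'p \<Rightarrow> real^'p" where
  "posterior_mean \<pi> y =
     (LINT \<theta>|lborel. (mvn_density 0 (mat 1) (y - \<theta>) * \<pi> \<theta>) *\<^sub>R \<theta>) /\<^sub>R
     (LINT \<theta>|lborel. mvn_density 0 (mat 1) (y - \<theta>) * \<pi> \<theta>)"

definition delta_bnn_fixed ::
    "nat \<Rightarrow> (nat \<Rightarrow> nat) \<Rightarrow> (nat \<Rightarrow> real) \<Rightarrow> real^'m \<Rightarrow> real^'p \<Rightarrow> real^'p" where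
  "delta_bnn_fixed d n \<sigma> x = posterior_mean (bnn_prior d n \<sigma> x)"

end

theory Submission
  imports Defs
begin

text \<open>
  Only three properties of the prior matter: it is nonnegative, has positive mass, and has finite moments
  of every order. Suppose its posterior mean \<open>\<delta>\<close> were minimax. The identity has constant risk \<open>p\<close>, so \<open>\<delta>\<close>
  has risk at most \<open>p\<close> everywhere. Averaging the risk over \<open>\<theta> \<sim> N(0, (s\<^sup>2 - 1) I)\<close>, whose Bayes risk is
  \<open>p (1 - 1 / s\<^sup>2)\<close>, shows that \<open>\<delta>(sZ)\<close> is within \<open>p / s\<^sup>2\<close> of \<open>(1 - 1 / s\<^sup>2) s Z\<close> in mean square for standard
  normal \<open>Z\<close>. Now \<open>\<delta>\<close> is a subgradient of the convex function
  \<open>l(y) = ln \<integral> exp (y \<bullet> \<theta> - \<bar>\<theta>\<bar>\<^sup>2 / 2) \<pi>(\<theta>) d\<theta>\<close>, so integrating along rays shows that the mean of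
  \<open>l(sZ) - \<bar>sZ\<bar>\<^sup>2 / 2\<close> over an annulus decreases at most like a multiple of \<open>ln s\<close>. But \<open>exp (l(y) - \<bar>y\<bar>\<^sup>2 / 2)\<close> is,
  up to a constant, the marginal density of the observation, which inherits from the moments of \<open>\<pi>\<close> a decay
  faster than every power of \<open>\<bar>y\<bar>\<close>.

  For the network prior, Mellin inversion of the Gamma function and Fubini turn the Mellin-Barnes
  integrals into iterated integrals of positive functions, whose moments are products of Gamma values.
\<close>

section \<open>Gaussian averages of the risk\<close>

text \<open>The density of N(0, v I) on any Euclidean space; \<open>v\<close> is the variance,
  whereas \<open>normal_density\<close> takes the standard deviation \<open>sqrt v\<close>.\<close>

definition gauss :: "real \<Rightarrow> 'a::euclidean_space \<Rightarrow> real" where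
  "gauss v u = exp (- (norm u)\<^sup>2 / (2 * v)) / sqrt ((2 * pi * v) ^ DIM('a))"

lemma gauss_pos: "v > 0 \<Longrightarrow> gauss v u > 0"
  by (simp add: gauss_def)

lemma gauss_nonneg: "v > 0 \<Longrightarrow> gauss v u \<ge> 0"
  using gauss_pos less_imp_le by blast

lemma borel_measurable_gauss [measurable]: "gauss v \<in> borel_measurable borel"
  unfolding gauss_def by measurable

lemma gauss_minus: "gauss v (- u) = gauss v u"
  by (simp add: gauss_def)

lemma norm2_eq_sum_Basis: "(norm u)\<^sup>2 = (\<Sum>b\<in>Basis. (u \<bullet> b)\<^sup>2)" for u :: "'a::euclidean_space"
  unfolding power2_norm_eq_inner by (subst euclidean_inner) (simp add: power2_eq_square)

lemma gauss_eq_prod_normal_density: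
  fixes u :: "'a::euclidean_space"
  assumes "v > 0"
  shows "gauss v u = (\<Prod>b\<in>Basis. normal_density 0 (sqrt v) (u \<bullet> b))"
proof -
  have "exp (- (norm u)\<^sup>2 / (2 * v)) = (\<Prod>b\<in>Basis. exp (- (u \<bullet> b)\<^sup>2 / (2 * v)))"
    by (simp add: norm2_eq_sum_Basis sum_divide_distrib sum_negf flip: exp_sum)
  moreover have "sqrt ((2 * pi * v) ^ DIM('a)) = (\<Prod>b\<in>(Basis::'a set). sqrt (2 * pi * v))"
    by (simp add: real_sqrt_power)
  ultimately show ?thesis
    using assms unfolding gauss_def normal_density_def
    by (simp add: prod_dividef)
qed

lemma nn_integral_gauss:
  fixes v :: real
  assumes "v > 0"
  shows "(\<integral>\<^sup>+u. ennreal (gauss v (u :: 'a::euclidean_space)) \<partial>lborel) = 1"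
proof -
  have "(\<integral>\<^sup>+x. ennreal (normal_density 0 (sqrt v) x) \<partial>lborel) = 1"
    using assms by (subst nn_integral_eq_integral) (auto simp: integrable_normal_density)
  then show ?thesis
    using assms nn_integral_lborel_prod[where 'a='a and f="\<lambda>_ x. ennreal (normal_density 0 (sqrt v) x)"]
    by (simp add: gauss_eq_prod_normal_density prod_ennreal)
qed

lemma nn_integral_gauss_norm2:
  fixes v :: real
  assumes "v > 0"
  shows "(\<integral>\<^sup>+u. ennreal (gauss v (u :: 'a::euclidean_space) * (norm u)\<^sup>2) \<partial>lborel) = ennreal (DIM('a) * v)"
proof -
  let ?N = "normal_density 0 (sqrt v)"
  have 0: "(\<integral>\<^sup>+x. ennreal (?N x) \<partial>lborel) = 1"
    using assms by (subst nn_integral_eq_integral) (auto simp: integrable_normal_density)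
  have "has_bochner_integral lborel (\<lambda>x. ?N x * x\<^sup>2) v"
    using assms normal_moment_even[of "sqrt v" 0 1] by simp
  then have 2: "(\<integral>\<^sup>+x. ennreal (?N x * x\<^sup>2) \<partial>lborel) = ennreal v"
    by (intro nn_integral_eq_integral[THEN trans])
      (auto simp: has_bochner_integral_iff)
  have *: "(\<integral>\<^sup>+u. ennreal (gauss v u * (u \<bullet> b)\<^sup>2) \<partial>lborel) = ennreal v" if b: "b \<in> Basis" for b :: 'a
  proof -
    \<comment> \<open>The square is absorbed into the factor of coordinate \<open>b\<close>, so the
      integrand stays a product over coordinates and the integral factors.\<close>
    have "gauss v u * (u \<bullet> b)\<^sup>2 = (\<Prod>c\<in>Basis. if c = b then ?N (u \<bullet> c) * (u \<bullet> c)\<^sup>2 else ?N (u \<bullet> c))" for u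
      using b assms unfolding gauss_eq_prod_normal_density[OF assms]
      by (simp add: prod.If_cases prod.remove[of _ b] Int_absorb1 Diff_eq[symmetric])
    then have "(\<integral>\<^sup>+u. ennreal (gauss v u * (u \<bullet> b)\<^sup>2) \<partial>lborel) =
       (\<integral>\<^sup>+u. (\<Prod>c\<in>Basis. ennreal (if c = b then ?N (u \<bullet> c) * (u \<bullet> c)\<^sup>2 else ?N (u \<bullet> c))) \<partial>lborel)"
      by (simp add: prod_ennreal)
    also have "\<dots> = (\<Prod>c\<in>Basis. \<integral>\<^sup>+x. ennreal (if c = b then ?N x * x\<^sup>2 else ?N x) \<partial>lborel)"
      by (intro nn_integral_lborel_prod) auto
    also have "\<dots> = (\<Prod>c\<in>Basis. if c = b then ennreal v else 1)"
      by (intro prod.cong refl) (auto simp: 0 2)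
    finally show ?thesis using b by simp
  qed
  have "(\<integral>\<^sup>+u. ennreal (gauss v (u :: 'a) * (norm u)\<^sup>2) \<partial>lborel) =
      (\<integral>\<^sup>+u. (\<Sum>b\<in>Basis. ennreal (gauss v (u :: 'a) * (u \<bullet> b)\<^sup>2)) \<partial>lborel)"
    using assms by (simp add: norm2_eq_sum_Basis sum_distrib_left gauss_nonneg sum_ennreal)
  also have "\<dots> = (\<Sum>b\<in>(Basis::'a set). ennreal v)"
    by (subst nn_integral_sum) (auto simp: *)
  finally show ?thesis using assms by (simp add: ennreal_mult ennreal_of_nat_eq_real_of_nat)
qed

lemma nn_integral_lborel_plus:
  fixes f :: "'a::euclidean_space \<Rightarrow> ennreal"
  assumes [measurable]: "f \<in> borel_measurable borel"
  shows "(\<integral>\<^sup>+u. f (a + u) \<partial>lborel) = (\<integral>\<^sup>+u. f u \<partial>lborel)"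
  by (subst (2) lborel_distr_plus[symmetric, of a]) (simp add: nn_integral_distr)

lemma nn_integral_lborel_scale:
  fixes f :: "'a::euclidean_space \<Rightarrow> ennreal"
  assumes [measurable]: "f \<in> borel_measurable borel" and s: "s \<noteq> 0"
  shows "(\<integral>\<^sup>+u. f u \<partial>lborel) = ennreal (\<bar>s\<bar> ^ DIM('a)) * (\<integral>\<^sup>+u. f (s *\<^sub>R u) \<partial>lborel)"
  by (subst lborel_affine[OF s, of 0])
     (simp add: nn_integral_density nn_integral_distr nn_integral_cmult)

text \<open>This is the bias-variance decomposition. Expanding the square would produce a signed
  cross term, which has no place in an \<open>ennreal\<close> integral; instead the reflection
  \<open>u \<mapsto> - u\<close> doubles the integral and the parallelogram law removes the cross
  term pointwise.\<close>

lemma nn_integral_gauss_shifted_norm2: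
  fixes a e :: "'a::euclidean_space" and v :: real
  assumes v: "v > 0"
  shows "(\<integral>\<^sup>+u. ennreal (gauss v (u - a) * (norm (u - e))\<^sup>2) \<partial>lborel)
       = ennreal (DIM('a) * v + (norm (e - a))\<^sup>2)" (is "?L = _")
proof -
  let ?F = "\<lambda>w u :: 'a. ennreal (gauss v u * (norm (u - w))\<^sup>2)"
  define w where "w = e - a"
  have L: "?L = (\<integral>\<^sup>+u. ?F w u \<partial>lborel)"
    using nn_integral_lborel_plus[of "?F w" "- a", symmetric]
    by (simp add: w_def algebra_simps)
  have M: "(\<integral>\<^sup>+u. ?F w u \<partial>lborel) = (\<integral>\<^sup>+u. ?F (- w) u \<partial>lborel)"
    using nn_integral_lborel_scale[of "?F w" "-1"]
    by (simp add: gauss_minus norm_minus_commute add.commute)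
  have "2 * ?L = (\<integral>\<^sup>+u. ?F w u \<partial>lborel) + (\<integral>\<^sup>+u. ?F (- w) u \<partial>lborel)"
    using L M by (simp add: mult_2)
  also have "\<dots> = (\<integral>\<^sup>+u. ?F w u + ?F (- w) u \<partial>lborel)"
    by (subst nn_integral_add) auto
  also have "\<dots> = (\<integral>\<^sup>+u. 2 * (ennreal (gauss v (u :: 'a) * (norm u)\<^sup>2) + ennreal ((norm w)\<^sup>2) * ennreal (gauss v u)) \<partial>lborel)"
  proof (intro nn_integral_cong)
    fix u :: 'a
    have "gauss v u * (norm (u - w))\<^sup>2 + gauss v u * (norm (u + w))\<^sup>2
       = 2 * (gauss v u * (norm u)\<^sup>2 + (norm w)\<^sup>2 * gauss v u)"
      by (simp add: power2_norm_eq_inner algebra_simps inner_commute)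
    then show "?F w u + ?F (- w) u = 2 * (ennreal (gauss v u * (norm u)\<^sup>2) + ennreal ((norm w)\<^sup>2) * ennreal (gauss v u))"
      using v by (simp add: gauss_nonneg ennreal_plus[symmetric] ennreal_mult[symmetric] ennreal_numeral[symmetric] 
          del: ennreal_plus ennreal_numeral)
  qed
  also have "\<dots> = 2 * ennreal (DIM('a) * v + (norm w)\<^sup>2)"
    using v by (subst nn_integral_cmult, simp, subst nn_integral_add)
      (auto simp: nn_integral_gauss_norm2 nn_integral_gauss nn_integral_cmult)
  finally show ?thesis
    by (simp add: ennreal_mult_cancel_left w_def)
qed

section \<open>The risk function and the bound forced by minimaxity\<close>

lemma mvn_density_mat_1: "mvn_density \<mu> (mat 1) y = gauss 1 (y - \<mu> :: real^'p)"
proof -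
  have "matrix_inv (mat 1 :: real^'p^'p) = mat 1"
    unfolding matrix_inv_def by (rule some_equality) (auto simp: matrix_mul_lid matrix_mul_rid)
  then show ?thesis
    by (simp add: mvn_density_def gauss_def power2_norm_eq_inner)
qed

lemma risk_eq:
  fixes \<theta> :: "real^'p"
  assumes [measurable]: "\<delta> \<in> borel_measurable borel"
  shows "risk \<theta> \<delta> = (\<integral>\<^sup>+y. ennreal (gauss 1 (y - \<theta>) * (norm (\<theta> - \<delta> y))\<^sup>2) \<partial>lborel)"
  by (simp add: risk_def mvn_def mvn_density_mat_1 nn_integral_density gauss_nonneg flip: ennreal_mult)

lemma risk_id: "risk \<theta> (\<lambda>y. y) = ennreal (CARD('p))" for \<theta> :: "real^'p"
  using nn_integral_gauss_shifted_norm2[of 1 \<theta> \<theta>]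
  by (simp add: risk_eq norm_minus_commute)

text \<open>The identity competes in the infimum, and its risk is constantly
  \<open>p\<close>.\<close>

lemma minimax_imp_risk_le:
  fixes \<delta> :: "real^'p \<Rightarrow> real^'p"
  assumes "minimax \<delta>"
  shows "risk \<theta> \<delta> \<le> ennreal (CARD('p))"
proof -
  have "risk \<theta> \<delta> \<le> (SUP \<theta>. risk \<theta> \<delta>)"
    by (rule SUP_upper) simp
  also have "\<dots> = (INF \<delta>'\<in>(borel_measurable borel :: (real^'p \<Rightarrow> real^'p) set). SUP \<theta>. risk \<theta> \<delta>')"
    using assms by (simp add: minimax_def)
  also have "\<dots> \<le> (SUP \<theta> :: real^'p. risk \<theta> (\<lambda>y. y))"
    by (rule INF_lower) simp
  finally show ?thesis by (simp add: risk_id)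
qed

text \<open>Under a centred normal prior of variance \<open>s\<^sup>2 - 1\<close>, the joint density
  factors into the marginal of \<open>y\<close>, of variance \<open>s\<^sup>2\<close>, and the
  posterior. The same \<open>c\<close> is both the shrinkage factor and the posterior
  variance.\<close>

lemma gauss_mult_gauss:
  fixes y \<theta> :: "'a::euclidean_space"
  assumes "s > 1"
  defines "c \<equiv> 1 - 1 / s\<^sup>2"
  shows "gauss 1 (y - \<theta>) * gauss (s\<^sup>2 - 1) \<theta> = gauss (s\<^sup>2) y * gauss c (\<theta> - c *\<^sub>R y)"
proof -
  have S: "s\<^sup>2 > 1" using assms(1) by (simp add: one_less_power)
  define S where "S = s\<^sup>2"
  have S1: "S > 1" "c = (S - 1) / S" using S assms(1) by (auto simp: S_def c_def diff_divide_distrib)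
  define A B D where "A = y \<bullet> y" and "B = y \<bullet> \<theta>" and "D = \<theta> \<bullet> \<theta>"
  have 1: "(norm (y - \<theta>))\<^sup>2 = A - 2 * B + D"
    by (simp add: power2_norm_eq_inner A_def B_def D_def inner_commute algebra_simps)
  have 2: "(norm (\<theta> - c *\<^sub>R y))\<^sup>2 = D - 2 * c * B + c\<^sup>2 * A"
    unfolding power2_norm_eq_inner
    by (simp add: A_def B_def D_def inner_commute algebra_simps power2_eq_square)
  have 3: "(norm \<theta>)\<^sup>2 = D" "(norm y)\<^sup>2 = A"
    by (simp_all add: power2_norm_eq_inner A_def D_def)
  have "- (A - 2 * B + D) / (2 * 1) + - D / (2 * (S - 1)) = - A / (2 * S) + - (D - 2 * c * B + c\<^sup>2 * A) / (2 * c)"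
  proof -
    have "A - 2 * B + D + D / (S - 1) = A / S + (D - 2 * c * B + c\<^sup>2 * A) / c"
    proof -
      \<comment> \<open>After removal of the common factor -1/2 the exponents agree once the
        coefficients of \<open>D\<close>, \<open>A\<close> and \<open>B\<close> are
        compared.\<close>
      have "D / c = D + D / (S - 1)" "c\<^sup>2 * A / c = A - A / S" "2 * c * B / c = 2 * B"
        unfolding S1(2) using S1(1) by (simp_all add: field_simps power2_eq_square)
      then show ?thesis by (simp add: diff_divide_distrib add_divide_distrib)
    qed
    moreover have "- u / (2 * v) = (- 1 / 2) * (u / v)" for u v :: real by simp
    ultimately show ?thesis by (simp only: distrib_left[symmetric] div_by_1)
  qed
  moreover have "sqrt ((2 * pi * 1) ^ DIM('a)) * sqrt ((2 * pi * (S - 1)) ^ DIM('a))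
     = sqrt ((2 * pi * S) ^ DIM('a)) * sqrt ((2 * pi * c) ^ DIM('a))"
  proof -
    have "2 * pi * 1 * (2 * pi * (S - 1)) = 2 * pi * S * (2 * pi * c)"
      using S1 by simp
    then show ?thesis by (simp only: real_sqrt_mult[symmetric] power_mult_distrib[symmetric])
  qed
  ultimately show ?thesis
    unfolding gauss_def 1 2 3 S_def[symmetric] times_divide_times_eq mult_exp_exp by simp
qed

text \<open>Averages the risk over a centred normal prior of variance \<open>s\<^sup>2 - 1\<close>, whose own Bayes rule is
  \<open>y \<mapsto> (1 - 1 / s\<^sup>2) y\<close>.\<close>

lemma risk_le_imp_close_to_linear:
  fixes \<delta> :: "real^'p \<Rightarrow> real^'p"
  assumes [measurable]: "\<delta> \<in> borel_measurable borel"
    and risk: "\<And>\<theta>. risk \<theta> \<delta> \<le> ennreal (CARD('p))" and s: "s > 1"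
  shows "(\<integral>\<^sup>+z. ennreal (gauss 1 z * (norm (\<delta> (s *\<^sub>R z) - (s - 1 / s) *\<^sub>R z))\<^sup>2) \<partial>lborel)
    \<le> ennreal (CARD('p) / s\<^sup>2)"
proof -
  let ?p = "real CARD('p)"
  define c where "c = 1 - 1 / s\<^sup>2"
  have S: "s\<^sup>2 > 1" using s by (simp add: one_less_power)
  have g0: "gauss (s\<^sup>2) y \<ge> 0" for y :: "real^'p" using s by (simp add: gauss_nonneg)
  have c: "c > 0" using s S by (simp add: c_def divide_less_eq)
  \<comment> \<open>\<open>X\<close> turns out to be the excess of the averaged risk over the Bayes
    risk \<open>?p * c\<close>.\<close>
  define X where "X = (\<integral>\<^sup>+y. ennreal (gauss (s\<^sup>2) y * (norm (\<delta> y - c *\<^sub>R y))\<^sup>2) \<partial>lborel)"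
  have "(\<integral>\<^sup>+\<theta>. ennreal (gauss (s\<^sup>2 - 1) (\<theta> :: real^'p)) * risk \<theta> \<delta> \<partial>lborel)
     \<le> (\<integral>\<^sup>+\<theta>. ennreal (gauss (s\<^sup>2 - 1) (\<theta> :: real^'p)) * ennreal ?p \<partial>lborel)"
    by (intro nn_integral_mono mult_left_mono risk) auto
  also have "\<dots> = ennreal ?p"
    using S by (simp add: nn_integral_multc nn_integral_gauss)
  also have "(\<integral>\<^sup>+\<theta>. ennreal (gauss (s\<^sup>2 - 1) (\<theta> :: real^'p)) * risk \<theta> \<delta> \<partial>lborel)
     = (\<integral>\<^sup>+\<theta>. (\<integral>\<^sup>+y. ennreal (gauss (s\<^sup>2 - 1) \<theta> * (gauss 1 (y - \<theta>) * (norm (\<theta> - \<delta> y))\<^sup>2)) \<partial>lborel) \<partial>lborel)"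
    using S by (simp add: risk_eq nn_integral_cmult[symmetric] ennreal_mult' gauss_nonneg)
  also have "\<dots> = (\<integral>\<^sup>+y. (\<integral>\<^sup>+\<theta>. ennreal (gauss (s\<^sup>2 - 1) \<theta> * (gauss 1 (y - \<theta>) * (norm (\<theta> - \<delta> y))\<^sup>2)) \<partial>lborel) \<partial>lborel)"
    by (rule lborel_pair.Fubini'[symmetric]) measurable
  also have "\<dots> = (\<integral>\<^sup>+y. ennreal (gauss (s\<^sup>2) y) * ennreal (?p * c + (norm (\<delta> y - c *\<^sub>R y))\<^sup>2) \<partial>lborel)"
  proof (intro nn_integral_cong)
    fix y :: "real^'p"
    have "gauss (s\<^sup>2 - 1) \<theta> * (gauss 1 (y - \<theta>) * (norm (\<theta> - \<delta> y))\<^sup>2)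
        = gauss (s\<^sup>2) y * (gauss c (\<theta> - c *\<^sub>R y) * (norm (\<theta> - \<delta> y))\<^sup>2)" for \<theta>
      using arg_cong[OF gauss_mult_gauss[OF s, of y \<theta>, folded c_def], of "\<lambda>x. x * (norm (\<theta> - \<delta> y))\<^sup>2"]
      by (simp only: mult_ac)
    then have "(\<integral>\<^sup>+\<theta>. ennreal (gauss (s\<^sup>2 - 1) \<theta> * (gauss 1 (y - \<theta>) * (norm (\<theta> - \<delta> y))\<^sup>2)) \<partial>lborel)
      = (\<integral>\<^sup>+\<theta>. ennreal (gauss (s\<^sup>2) y) * ennreal (gauss c (\<theta> - c *\<^sub>R y) * (norm (\<theta> - \<delta> y))\<^sup>2) \<partial>lborel)"
      by (simp only: ennreal_mult'[OF g0])
    also have "\<dots> = ennreal (gauss (s\<^sup>2) y) * ennreal (?p * c + (norm (\<delta> y - c *\<^sub>R y))\<^sup>2)"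
      by (subst nn_integral_cmult) (simp_all add: nn_integral_gauss_shifted_norm2[OF c])
    finally show "(\<integral>\<^sup>+\<theta>. ennreal (gauss (s\<^sup>2 - 1) \<theta> * (gauss 1 (y - \<theta>) * (norm (\<theta> - \<delta> y))\<^sup>2)) \<partial>lborel)
      = ennreal (gauss (s\<^sup>2) y) * ennreal (?p * c + (norm (\<delta> y - c *\<^sub>R y))\<^sup>2)" .
  qed
  also have "\<dots> = (\<integral>\<^sup>+y. ennreal (gauss (s\<^sup>2) y) * ennreal (?p * c) +
      ennreal (gauss (s\<^sup>2) y * (norm (\<delta> y - c *\<^sub>R y))\<^sup>2) \<partial>lborel)"
  proof (intro nn_integral_cong)
    fix y :: "real^'p"
    have "?p * c \<ge> 0" using c by simp
    then show "ennreal (gauss (s\<^sup>2) y) * ennreal (?p * c + (norm (\<delta> y - c *\<^sub>R y))\<^sup>2)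
      = ennreal (gauss (s\<^sup>2) y) * ennreal (?p * c) + ennreal (gauss (s\<^sup>2) y * (norm (\<delta> y - c *\<^sub>R y))\<^sup>2)"
      by (simp only: ennreal_plus zero_le_power2 distrib_left ennreal_mult'[OF g0])
  qed
  also have "\<dots> = ennreal (?p * c) + X"
    using s by (subst nn_integral_add) (auto simp: X_def nn_integral_multc nn_integral_gauss)
  finally have "ennreal (?p * c) + X \<le> ennreal ?p" .
  \<comment> \<open>The Bayes risk is finite and can be cancelled, which leaves
    \<open>p - p * c = p / s\<^sup>2\<close> for the excess.\<close>
  also have "ennreal ?p = ennreal (?p * c) + ennreal (?p / s\<^sup>2)"
    using c by (simp add: c_def flip: ennreal_plus) (simp add: algebra_simps)
  finally have X: "X \<le> ennreal (?p / s\<^sup>2)"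
    by (simp add: ennreal_add_left_cancel_le)
  \<comment> \<open>The substitution \<open>y = s *\<^sub>R z\<close> makes the normal law standard
    and turns \<open>c *\<^sub>R y\<close> into \<open>(s - 1 / s) *\<^sub>R z\<close>.\<close>
  have sc: "s * c = s - 1 / s"
    using s by (simp add: c_def field_simps power2_eq_square)
  have g: "s ^ CARD('p) * gauss (s\<^sup>2) (s *\<^sub>R z) = gauss 1 z" for z :: "real^'p"
  proof -
    have "sqrt ((2 * pi * s\<^sup>2) ^ CARD('p)) = s ^ CARD('p) * sqrt ((2 * pi) ^ CARD('p))"
      using s by (simp add: power_mult_distrib real_sqrt_mult power2_eq_square)
    then show ?thesis
      using s by (simp add: gauss_def power_mult_distrib)
  qed
  have "X = (\<integral>\<^sup>+z. ennreal (s ^ CARD('p)) * ennreal (gauss (s\<^sup>2) (s *\<^sub>R z) * (norm (\<delta> (s *\<^sub>R z) - c *\<^sub>R (s *\<^sub>R z)))\<^sup>2) \<partial>lborel)"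
    unfolding X_def using s by (subst nn_integral_lborel_scale[of _ s]) (auto simp: nn_integral_cmult)
  also have "\<dots> = (\<integral>\<^sup>+z. ennreal (gauss 1 z * (norm (\<delta> (s *\<^sub>R z) - (s - 1 / s) *\<^sub>R z))\<^sup>2) \<partial>lborel)"
  proof (intro nn_integral_cong)
    fix z :: "real^'p"
    have "c *\<^sub>R (s *\<^sub>R z) = (s - 1 / s) *\<^sub>R z"
      by (simp add: sc[symmetric] mult.commute)
    moreover have "0 \<le> s ^ CARD('p)" using s by simp
    ultimately show "ennreal (s ^ CARD('p)) * ennreal (gauss (s\<^sup>2) (s *\<^sub>R z) * (norm (\<delta> (s *\<^sub>R z) - c *\<^sub>R (s *\<^sub>R z)))\<^sup>2)
      = ennreal (gauss 1 z * (norm (\<delta> (s *\<^sub>R z) - (s - 1 / s) *\<^sub>R z))\<^sup>2)"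
      by (simp only: g[symmetric] mult.assoc ennreal_mult'[symmetric])
  qed
  finally show ?thesis using X by simp
qed

section \<open>Priors with finite moments\<close>

lemma power_le_fact_exp:
  fixes x :: real
  assumes "x \<ge> 0"
  shows "x ^ k \<le> fact k * exp x"
proof -
  have "(\<Sum>n\<in>{k}. x ^ n /\<^sub>R fact n) \<le> (\<Sum>n. x ^ n /\<^sub>R fact n)"
    using assms by (intro sum_le_suminf) (auto simp: summable_exp)
  then show ?thesis
    by (simp add: exp_def divide_simps mult.commute)
qed

lemma power_mult_exp_minus_square_le:
  fixes x :: real
  assumes "x \<ge> 0"
  shows "x ^ k * exp (- x\<^sup>2 / 2) \<le> fact k * exp (1 / 2)"
proof -
  have "0 \<le> (x - 1)\<^sup>2" by simp
  then have "x + - x\<^sup>2 / 2 \<le> 1 / 2"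
    by (simp add: power2_eq_square algebra_simps)
  then have "fact k * exp (x + - x\<^sup>2 / 2) \<le> fact k * exp (1 / 2)"
    by simp
  moreover have "x ^ k * exp (- x\<^sup>2 / 2) \<le> fact k * exp x * exp (- x\<^sup>2 / 2)"
    by (intro mult_right_mono power_le_fact_exp assms) simp
  ultimately show ?thesis by (simp only: mult.assoc exp_add)
qed

lemma power_add_le:
  fixes a b :: real
  assumes "a \<ge> 0" "b \<ge> 0"
  shows "(a + b) ^ k \<le> 2 ^ k * (a ^ k + b ^ k)"
proof -
  have "(a + b) ^ k \<le> (2 * max a b) ^ k"
    using assms by (intro power_mono) auto
  also have "\<dots> \<le> 2 ^ k * (a ^ k + b ^ k)"
    using assms by (auto simp: power_mult_distrib max_def)
  finally show ?thesis .
qed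

text \<open>The mass is not normalised, since rescaling \<open>\<pi>\<close> by a positive constant
  leaves the posterior mean unchanged.\<close>

locale finite_moments_prior =
  fixes \<pi> :: "real^'p \<Rightarrow> real"
  assumes measurable_prior [measurable]: "\<pi> \<in> borel_measurable borel"
    and prior_nonneg: "\<And>\<theta>. \<pi> \<theta> \<ge> 0"
    and integrable_moment: "\<And>k. integrable lborel (\<lambda>\<theta>. norm \<theta> ^ k * \<pi> \<theta>)"
    and integral_prior_pos: "(LINT \<theta>|lborel. \<pi> \<theta>) > 0"
begin

text \<open>The unnormalised posterior density without the factor
  \<open>exp (- (norm y)\<^sup>2 / 2)\<close> of the likelihood; what remains is an exponential
  family with natural parameter \<open>y\<close>.\<close>

definition tilt :: "real^'p \<Rightarrow> real^'p \<Rightarrow> real" where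
  "tilt y \<theta> = exp (y \<bullet> \<theta> - (norm \<theta>)\<^sup>2 / 2) * \<pi> \<theta>"

text \<open>The logarithmic Laplace transform of the measure with density
  \<open>exp (- (norm \<theta>)\<^sup>2 / 2) * \<pi> \<theta>\<close>.\<close>

definition cumulant :: "real^'p \<Rightarrow> real" where
  "cumulant y = ln (LINT \<theta>|lborel. tilt y \<theta>)"

lemma measurable_tilt [measurable]: "(\<lambda>(y, \<theta>). tilt y \<theta>) \<in> borel_measurable (borel \<Otimes>\<^sub>M borel)"
  unfolding tilt_def by measurable

lemma measurable_tilt' [measurable]: "tilt y \<in> borel_measurable borel"
  unfolding tilt_def by measurable

lemma tilt_nonneg: "tilt y \<theta> \<ge> 0"
  by (simp add: tilt_def prior_nonneg)

lemma integrable_prior: "integrable lborel \<pi>"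
  using integrable_moment[of 0] by simp

text \<open>Completing the square recovers the Gaussian kernel in \<open>y - \<theta>\<close>. That
  kernel is at most 1, so integrability passes from the prior to its tilted versions.\<close>

lemma tilt_eq: "tilt y \<theta> = exp ((norm y)\<^sup>2 / 2) * (exp (- (norm (y - \<theta>))\<^sup>2 / 2) * \<pi> \<theta>)"
proof -
  have "y \<bullet> \<theta> - (norm \<theta>)\<^sup>2 / 2 = (norm y)\<^sup>2 / 2 + - (norm (y - \<theta>))\<^sup>2 / 2"
    unfolding power2_norm_eq_inner
    by (simp add: algebra_simps inner_commute[of \<theta> y]) (simp add: field_simps)
  then show ?thesis by (simp only: tilt_def exp_add mult.assoc)
qed

lemma tilt_le: "tilt y \<theta> \<le> exp ((norm y)\<^sup>2 / 2) * \<pi> \<theta>"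
  unfolding tilt_eq by (intro mult_left_mono) (simp_all add: prior_nonneg mult_left_le_one_le)

lemma integrable_tilt: "integrable lborel (tilt y)"
  by (rule Bochner_Integration.integrable_bound[where f="\<lambda>\<theta>. exp ((norm y)\<^sup>2 / 2) * \<pi> \<theta>"])
     (auto simp: integrable_prior tilt_nonneg prior_nonneg tilt_le)

lemma integrable_tilt_id: "integrable lborel (\<lambda>\<theta>. tilt y \<theta> *\<^sub>R \<theta>)"
proof (rule Bochner_Integration.integrable_bound[where f="\<lambda>\<theta>. exp ((norm y)\<^sup>2 / 2) * (norm \<theta> ^ 1 * \<pi> \<theta>)"])
  show "AE \<theta> in lborel. norm (tilt y \<theta> *\<^sub>R \<theta>) \<le> norm (exp ((norm y)\<^sup>2 / 2) * (norm \<theta> ^ 1 * \<pi> \<theta>))"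
    using mult_right_mono[OF tilt_le, of "norm \<theta>" for \<theta>]
    by (auto simp: tilt_nonneg prior_nonneg mult_ac)
qed (use integrable_moment[of 1] in simp_all)

lemma integral_tilt_pos: "(LINT \<theta>|lborel. tilt y \<theta>) > 0"
proof -
  have "\<not> (AE \<theta> in lborel. tilt y \<theta> = 0)"
  proof
    assume "AE \<theta> in lborel. tilt y \<theta> = 0"
    then have "AE \<theta> in lborel. \<pi> \<theta> = 0" by (simp add: tilt_def)
    then have "(LINT \<theta>|lborel. \<pi> \<theta>) = 0" by (rule integral_eq_zero_AE)
    then show False using integral_prior_pos by simp
  qed
  moreover have "(LINT \<theta>|lborel. tilt y \<theta>) \<ge> 0" by (simp add: tilt_nonneg)
  ultimately show ?thesis
    using integral_nonneg_eq_0_iff_AE[OF integrable_tilt, of y] by (auto simp: tilt_nonneg less_le)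
qed

lemma posterior_mean_eq:
  "posterior_mean \<pi> y = (LINT \<theta>|lborel. tilt y \<theta> *\<^sub>R \<theta>) /\<^sub>R (LINT \<theta>|lborel. tilt y \<theta>)"
proof -
  define C where "C = 1 / (exp ((norm y)\<^sup>2 / 2) * sqrt ((2 * pi) ^ CARD('p)))"
  have C: "C \<noteq> 0" by (simp add: C_def)
  have *: "mvn_density 0 (mat 1) (y - \<theta>) * \<pi> \<theta> = C * tilt y \<theta>" for \<theta>
    by (simp add: mvn_density_mat_1 tilt_eq gauss_def C_def)
  have "(LINT \<theta>|lborel. (C * tilt y \<theta>) *\<^sub>R \<theta>) = C *\<^sub>R (LINT \<theta>|lborel. tilt y \<theta> *\<^sub>R \<theta>)"
    by (simp flip: scaleR_scaleR)
  then show ?thesis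
    unfolding posterior_mean_def * using C by simp
qed

lemma measurable_posterior_mean [measurable]: "posterior_mean \<pi> \<in> borel_measurable borel"
  unfolding posterior_mean_eq[abs_def] by measurable

text \<open>Jensen's inequality for the posterior at \<open>y\<close>: the exponential is bounded
  below by its tangent at \<open>u\<close>, the posterior mean of
  \<open>\<theta> \<bullet> (y' - y)\<close>, and the linear term integrates to zero. No
  differentiation under the integral sign is involved.\<close>

lemma cumulant_subgradient:
  "cumulant y' \<ge> cumulant y + posterior_mean \<pi> y \<bullet> (y' - y)"
proof -
  define P where "P y = (LINT \<theta>|lborel. tilt y \<theta>)" for y
  define u where "u = posterior_mean \<pi> y \<bullet> (y' - y)"
  have "exp u * (tilt y \<theta> + ((y' - y) \<bullet> (tilt y \<theta> *\<^sub>R \<theta>) - u * tilt y \<theta>)) \<le> tilt y' \<theta>" for \<theta>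
  proof -
    have "exp u * (1 + ((y' - y) \<bullet> \<theta> - u)) \<le> exp u * exp ((y' - y) \<bullet> \<theta> - u)"
      by (intro mult_left_mono exp_ge_add_one_self) simp
    also have "\<dots> = exp ((y' - y) \<bullet> \<theta>)" by (simp flip: exp_add)
    finally have "exp u * (1 + ((y' - y) \<bullet> \<theta> - u)) * tilt y \<theta> \<le> exp ((y' - y) \<bullet> \<theta>) * tilt y \<theta>"
      by (rule mult_right_mono) (rule tilt_nonneg)
    also have "\<dots> = tilt y' \<theta>"
      by (simp add: tilt_def inner_diff_left flip: exp_add mult.assoc)
    finally show ?thesis by (simp add: algebra_simps)
  qed
  then have "(LINT \<theta>|lborel. exp u * (tilt y \<theta> + ((y' - y) \<bullet> (tilt y \<theta> *\<^sub>R \<theta>) - u * tilt y \<theta>))) \<le> P y'"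
    unfolding P_def
    by (intro integral_mono integrable_tilt integrable_mult_right Bochner_Integration.integrable_add
        Bochner_Integration.integrable_diff integrable_inner_right integrable_tilt_id) auto
  also have "(LINT \<theta>|lborel. exp u * (tilt y \<theta> + ((y' - y) \<bullet> (tilt y \<theta> *\<^sub>R \<theta>) - u * tilt y \<theta>)))
    = exp u * (P y + ((y' - y) \<bullet> (LINT \<theta>|lborel. tilt y \<theta> *\<^sub>R \<theta>) - u * P y))"
    by (simp add: P_def integrable_tilt integrable_tilt_id integrable_inner_right del: inner_scaleR_right)
  also have "(LINT \<theta>|lborel. tilt y \<theta> *\<^sub>R \<theta>) = P y *\<^sub>R posterior_mean \<pi> y"
    using integral_tilt_pos[of y] by (simp add: posterior_mean_eq P_def)
  finally have "exp u * P y \<le> P y'"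
    by (simp add: u_def inner_commute)
  then have "ln (exp u * P y) \<le> ln (P y')"
    using integral_tilt_pos[of y] integral_tilt_pos[of y'] by (simp add: P_def)
  then show ?thesis
    using integral_tilt_pos[of y] by (simp add: ln_mult cumulant_def P_def u_def)
qed

text \<open>The subgradient at an intermediate point, used towards both ends, gives convexity, and a
  finite convex function on the whole space is continuous.\<close>

lemma continuous_cumulant: "continuous_on UNIV cumulant"
proof (rule convex_on_continuous)
  show "convex_on UNIV cumulant"
  proof (rule convex_onI)
    fix t :: real and x y :: "real^'p"
    assume t: "0 < t" "t < 1"
    define w where "w = (1 - t) *\<^sub>R x + t *\<^sub>R y"
    let ?d = "posterior_mean \<pi> w"
    have "(1 - t) * (cumulant w + ?d \<bullet> (x - w)) \<le> (1 - t) * cumulant x"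
      using t by (intro mult_left_mono cumulant_subgradient) auto
    moreover have "t * (cumulant w + ?d \<bullet> (y - w)) \<le> t * cumulant y"
      using t by (intro mult_left_mono cumulant_subgradient) auto
    moreover have "(1 - t) * (?d \<bullet> (x - w)) + t * (?d \<bullet> (y - w)) = 0"
      by (simp add: w_def algebra_simps)
    ultimately show "cumulant ((1 - t) *\<^sub>R x + t *\<^sub>R y) \<le> (1 - t) * cumulant x + t * cumulant y"
      unfolding w_def[symmetric] by (simp add: algebra_simps)
  qed simp
qed simp

lemma measurable_cumulant [measurable]: "cumulant \<in> borel_measurable borel"
  using continuous_cumulant by (rule borel_measurable_continuous_onI)

text \<open>Since \<open>norm y \<le> norm (y - \<theta>) + norm \<theta>\<close>, the
  \<open>k\<close>-th power of \<open>norm y\<close> splits into a part absorbed by the Gaussian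
  kernel and a part absorbed by the \<open>k\<close>-th moment of the prior.\<close>

lemma cumulant_upper_bound:
  "\<exists>C>0. \<forall>y. y \<noteq> 0 \<longrightarrow> cumulant y \<le> (norm y)\<^sup>2 / 2 + ln C - k * ln (norm y)" for k :: nat
proof -
  \<comment> \<open>\<open>D\<close> bounds \<open>x ^ k * exp (- x\<^sup>2 / 2)\<close> for
    nonnegative \<open>x\<close>; the factor \<open>2 ^ k\<close> in \<open>C\<close> comes from
    \<open>power_add_le\<close>.\<close>
  define D :: real where "D = fact k * exp (1 / 2)"
  define C where "C = 2 ^ k * (D * (LINT \<theta>|lborel. \<pi> \<theta>) + (LINT \<theta>|lborel. norm \<theta> ^ k * \<pi> \<theta>))"
  have D: "D > 0" by (simp add: D_def)
  have C: "C > 0"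
    unfolding C_def using D integral_prior_pos
    by (intro mult_pos_pos add_pos_nonneg Bochner_Integration.integral_nonneg) (auto simp: prior_nonneg)
  have "cumulant y \<le> (norm y)\<^sup>2 / 2 + ln C - k * ln (norm y)" if y: "y \<noteq> 0" for y
  proof -
    define P where "P = (LINT \<theta>|lborel. tilt y \<theta>)"
    have P: "P > 0" using integral_tilt_pos by (simp add: P_def)
    have "norm y ^ k * exp (- (norm y)\<^sup>2 / 2) * tilt y \<theta> \<le> 2 ^ k * (D * \<pi> \<theta> + norm \<theta> ^ k * \<pi> \<theta>)" for \<theta>
    proof -
      let ?e = "exp (- (norm (y - \<theta>))\<^sup>2 / 2)"
      have "norm y \<le> norm (y - \<theta>) + norm \<theta>" by (metis norm_triangle_sub add.commute)
      then have "norm y ^ k \<le> (norm (y - \<theta>) + norm \<theta>) ^ k" by (intro power_mono) auto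
      also have "\<dots> \<le> 2 ^ k * (norm (y - \<theta>) ^ k + norm \<theta> ^ k)" by (rule power_add_le) auto
      finally have "norm y ^ k * ?e \<le> 2 ^ k * (norm (y - \<theta>) ^ k + norm \<theta> ^ k) * ?e"
        by (rule mult_right_mono) simp
      also have "\<dots> = 2 ^ k * (norm (y - \<theta>) ^ k * ?e + norm \<theta> ^ k * ?e)" by (simp add: algebra_simps)
      also have "\<dots> \<le> 2 ^ k * (D + norm \<theta> ^ k)"
        unfolding D_def by (intro mult_left_mono add_mono power_mult_exp_minus_square_le)
           (auto simp: mult_left_le)
      finally have "norm y ^ k * ?e * \<pi> \<theta> \<le> 2 ^ k * (D + norm \<theta> ^ k) * \<pi> \<theta>"
        by (rule mult_right_mono) (rule prior_nonneg)
      moreover have "exp (- (norm y)\<^sup>2 / 2) * tilt y \<theta> = ?e * \<pi> \<theta>"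
        unfolding tilt_eq by (simp flip: exp_add mult.assoc)
      ultimately show ?thesis by (simp only: mult.assoc) (simp add: algebra_simps)
    qed
    then have "(LINT \<theta>|lborel. norm y ^ k * exp (- (norm y)\<^sup>2 / 2) * tilt y \<theta>)
       \<le> (LINT \<theta>|lborel. 2 ^ k * (D * \<pi> \<theta> + norm \<theta> ^ k * \<pi> \<theta>))"
      by (intro integral_mono integrable_mult_right integrable_tilt Bochner_Integration.integrable_add
         integrable_prior integrable_moment) auto
    then have "norm y ^ k * exp (- (norm y)\<^sup>2 / 2) * P \<le> C"
      by (simp add: P_def C_def integrable_prior integrable_moment)
    then have "ln (norm y ^ k * exp (- (norm y)\<^sup>2 / 2) * P) \<le> ln C"
      using y P C by (subst ln_le_cancel_iff) auto
    then show ?thesis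
      using y P by (simp add: ln_mult ln_realpow cumulant_def P_def[symmetric])
  qed
  with C show ?thesis by blast
qed

end

text \<open>The hypothesis is a discrete form of the differential inequality
  \<open>N' \<ge> - b / s\<close>. When the interval from \<open>t\<close> to \<open>2 * t\<close>
  is cut into \<open>K\<close> equal steps, the first-order losses add up to at most
  \<open>b\<close>, while the quadratic ones total \<open>t\<^sup>2 * a / (2 * K)\<close> and vanish
  as \<open>K\<close> grows.\<close>

lemma growth_from_steps:
  fixes N :: "real \<Rightarrow> real"
  assumes ab: "a \<ge> 0" "b \<ge> 0" and t: "t > 1"
    and step: "\<And>s h. s > 1 \<Longrightarrow> h \<ge> 0 \<Longrightarrow> N (s + h) \<ge> N s - h * b / s - h\<^sup>2 * a / 2"
  shows "N (2 * t) \<ge> N t - b"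
proof -
  have K: "N (2 * t) \<ge> N t - b - (t\<^sup>2 * a / 2) * (1 / real (Suc m))" for m
  proof -
    define K where "K = real (Suc m)"
    define h where "h = t / K"
    have K: "K > 0" by (simp add: K_def)
    have h: "h \<ge> 0" using t K by (simp add: h_def)
    \<comment> \<open>All subdivision points are at least \<open>t\<close>, so
      \<open>\<beta>\<close> bounds the loss of every single step.\<close>
    define \<beta> where "\<beta> = h * b / t + h\<^sup>2 * a / 2"
    have "N (t + j * h) \<ge> N t - j * \<beta>" for j :: nat
    proof (induction j)
      case (Suc j)
      have s: "t + j * h \<ge> t" using h by simp
      then have "t + j * h > 0" using t by linarith
      then have "h * b / (t + j * h) \<le> h * b / t"
        using divide_left_mono[OF s, of "h * b"] t h ab by simp
      then have "N (t + j * h + h) \<ge> N (t + j * h) - \<beta>"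
        unfolding \<beta>_def using step[of "t + j * h" h] s t h by simp
      with Suc show ?case by (simp add: algebra_simps)
    qed simp
    from this[of "Suc m"] have "N (t + K * h) \<ge> N t - K * \<beta>"
      by (simp add: K_def)
    moreover have "K * h = t" "K * \<beta> = b + (t\<^sup>2 * a / 2) * (1 / K)"
      using K t by (auto simp: \<beta>_def h_def field_simps power2_eq_square)
    ultimately show ?thesis by (simp add: K_def)
  qed
  have "(\<lambda>m. N t - b - (t\<^sup>2 * a / 2) * (1 / real (Suc m))) \<longlonglongrightarrow> N t - b - (t\<^sup>2 * a / 2) * 0"
    by (intro tendsto_intros LIMSEQ_Suc lim_1_over_n)
  then show ?thesis
    using K by (intro LIMSEQ_le_const2[where X="\<lambda>m. N t - b - (t\<^sup>2 * a / 2) * (1 / real (Suc m))"]) auto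
qed

section \<open>Averages over an annulus and the contradiction\<close>

context finite_moments_prior
begin

text \<open>The standard normal distribution restricted to an annulus, on which the functions
  \<open>z \<mapsto> cumulant (s *\<^sub>R z)\<close> are bounded, so that their integrals exist.\<close>

definition annulus_measure :: "(real^'p) measure" where
  "annulus_measure =
     density lborel (\<lambda>z. ennreal (indicator {z. 1 \<le> norm z \<and> norm z \<le> 2} z * gauss 1 z))"

lemma sets_annulus_measure [measurable_cong]: "sets annulus_measure = sets borel"
  by (simp add: annulus_measure_def)

lemma space_annulus_measure: "space annulus_measure = UNIV"
  by (simp add: annulus_measure_def)

lemma nn_integral_annulus_le:
  assumes [measurable]: "f \<in> borel_measurable borel" 
  shows "(\<integral>\<^sup>+z. ennreal (f z) \<partial>annulus_measure) \<le> (\<integral>\<^sup>+z. ennreal (gauss 1 z * f z) \<partial>lborel)"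
  unfolding annulus_measure_def
  by (subst nn_integral_density)
     (auto intro!: nn_integral_mono simp: ennreal_mult'[OF gauss_nonneg] split: split_indicator)

lemma AE_annulus: "AE z in annulus_measure. 1 \<le> norm z \<and> norm z \<le> 2"
  unfolding annulus_measure_def by (subst AE_density) (auto split: split_indicator_asm)

sublocale annulus: finite_measure annulus_measure
proof
  have "emeasure annulus_measure (space annulus_measure) = (\<integral>\<^sup>+z. ennreal 1 \<partial>annulus_measure)"
    by simp
  also have "\<dots> \<le> (\<integral>\<^sup>+z. ennreal (gauss 1 (z :: real^'p) * 1) \<partial>lborel)"
    by (rule nn_integral_annulus_le) simp
  also have "\<dots> = 1" by (simp add: nn_integral_gauss)
  finally show "emeasure annulus_measure (space annulus_measure) \<noteq> \<infinity>"
    using neq_top_trans[of 1] by simp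
qed

lemma annulus_pos: "measure annulus_measure UNIV > 0"
proof -
  let ?A = "{z :: real^'p. 1 \<le> norm z \<and> norm z \<le> 2}"
  have "emeasure annulus_measure UNIV \<noteq> 0"
  proof
    assume "emeasure annulus_measure UNIV = 0"
    then have "AE z in annulus_measure. False"
      by (intro AE_I[where N=UNIV]) (auto simp: annulus_measure_def)
    then have "AE z in lborel. z \<notin> ?A"
      unfolding annulus_measure_def using gauss_pos[of 1]
      by (subst (asm) AE_density) (auto split: split_indicator_asm elim!: eventually_mono)
    then have "emeasure lborel ?A = 0"
      using AE_iff_measurable[of ?A lborel "\<lambda>z. z \<notin> ?A"] by auto
    \<comment> \<open>A centre halfway between the two radii leaves room for a ball of radius 1/2,
      which has positive volume.\<close>
    moreover obtain e :: "real^'p" where e: "norm e = 3 / 2"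
      using vector_choose_size[of "3 / 2"] by auto
    have "ball e (1 / 2) \<subseteq> ?A"
    proof
      fix z assume "z \<in> ball e (1 / 2)"
      then have "norm (e - z) < 1 / 2" by (simp add: dist_norm)
      then show "z \<in> ?A"
        using e norm_triangle_ineq2[of e z] norm_triangle_ineq2[of z e] by (auto simp: norm_minus_commute)
    qed
    then have "emeasure lborel (ball e (1 / 2)) \<le> emeasure lborel ?A"
      by (intro emeasure_mono) auto
    moreover have "emeasure lborel (ball e (1 / 2)) \<noteq> 0"
      using open_not_negligible[of "ball e (1 / 2)"] by (auto simp: negligible_iff_null_sets null_sets_completionI)
    ultimately show False by simp
  qed
  then show ?thesis
    by (simp add: annulus.emeasure_eq_measure zero_less_measure_iff)
qed

lemma not_minimax_posterior_mean: "\<not> minimax (posterior_mean \<pi>)"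
proof
  assume "minimax (posterior_mean \<pi>)"
  then have risk: "risk \<theta> (posterior_mean \<pi>) \<le> ennreal CARD('p)" for \<theta> :: "real^'p"
    by (rule minimax_imp_risk_le)
  let ?M = annulus_measure
  let ?p = "real CARD('p)"
  let ?l = "\<lambda>s z. cumulant (s *\<^sub>R z)"
  have bounded_integrable: "integrable ?M f"
    if [measurable]: "f \<in> borel_measurable borel" and "\<And>z. 1 \<le> norm z \<Longrightarrow> norm z \<le> 2 \<Longrightarrow> \<bar>f z\<bar> \<le> B" for f :: "real^'p \<Rightarrow> real" and B
  proof (rule annulus.integrable_const_bound[of _ B])
    show "AE z in ?M. norm (f z) \<le> B"
      using AE_annulus by eventually_elim (simp add: that)
  qed measurable
  have int_sq: "integrable ?M (\<lambda>z. (norm z)\<^sup>2)"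
  proof (rule bounded_integrable[where B="2\<^sup>2"])
    show "\<bar>(norm z)\<^sup>2\<bar> \<le> 2\<^sup>2" if "norm z \<le> 2" for z :: "real^'p"
      using power_mono[OF that norm_ge_zero, of 2] by simp
  qed measurable
  have int_l: "integrable ?M (?l s)" for s
  proof -
    have "compact (cball 0 (2 * \<bar>s\<bar>) :: (real^'p) set)" by simp
    then have "bounded (cumulant ` cball 0 (2 * \<bar>s\<bar>))"
      by (intro compact_imp_bounded compact_continuous_image continuous_on_subset[OF continuous_cumulant]) auto
    then obtain B where B: "\<And>y. norm y \<le> 2 * \<bar>s\<bar> \<Longrightarrow> \<bar>cumulant y\<bar> \<le> B"
      unfolding bounded_iff by (metis image_eqI mem_cball_0 real_norm_def)
    show ?thesis
      by (rule bounded_integrable[where B=B]) (auto intro!: B simp: mult.commute mult_left_mono)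
  qed
  define a where "a = (LINT z|?M. (norm z)\<^sup>2)"
  \<comment> \<open>\<open>b\<close> collects the terms of order \<open>1 / s\<close> in the
    increment: \<open>a\<close> from the shrinkage \<open>s - 1 / s\<close>, and
    \<open>(a + ?p) / 2\<close> from the deviation \<open>e\<close> from the linear rule.\<close>
  define b where "b = (3 * a + ?p) / 2"
  \<comment> \<open>Up to an additive constant, this integrates the logarithm of the marginal
    density at \<open>s *\<^sub>R z\<close> over the annulus.\<close>
  define N where "N s = (LINT z|?M. ?l s z) - s\<^sup>2 * a / 2" for s
  have a: "a \<ge> 0" by (simp add: a_def)
  have b: "b \<ge> 0" using a by (simp add: b_def)
  have step: "N (s + h) \<ge> N s - h * b / s - h\<^sup>2 * a / 2" if s: "s > 1" and h: "h \<ge> 0" for s h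
  proof -
    define e where "e z = posterior_mean \<pi> (s *\<^sub>R z) - (s - 1 / s) *\<^sub>R z" for z
    have [measurable]: "e \<in> borel_measurable borel" unfolding e_def by measurable
    have "(\<integral>\<^sup>+z. ennreal ((norm (e z))\<^sup>2) \<partial>?M) \<le> (\<integral>\<^sup>+z. ennreal (gauss 1 z * (norm (e z))\<^sup>2) \<partial>lborel)"
      by (rule nn_integral_annulus_le) measurable
    also have "\<dots> \<le> ennreal (?p / s\<^sup>2)"
      unfolding e_def by (rule risk_le_imp_close_to_linear[OF _ risk s]) measurable
    finally have e: "(\<integral>\<^sup>+z. ennreal ((norm (e z))\<^sup>2) \<partial>?M) \<le> ennreal (?p / s\<^sup>2)" .
    have int_e: "integrable ?M (\<lambda>z. (norm (e z))\<^sup>2)"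
      using e by (intro integrableI_nonneg) (auto simp: le_less_trans)
    have E: "(LINT z|?M. (norm (e z))\<^sup>2) \<le> ?p / s\<^sup>2"
      using e by (subst (asm) nn_integral_eq_integral[OF int_e]) auto
    \<comment> \<open>The subgradient inequality along the ray through \<open>z\<close>. The weight
      \<open>s\<close> in Young's inequality balances the errors: after integration both
      \<open>s * (norm (e z))\<^sup>2\<close> and \<open>(norm z)\<^sup>2 / s\<close> are of order
      \<open>1 / s\<close>.\<close>
    have ptw: "h * ((s - 1 / s) * (norm z)\<^sup>2 - (s * (norm (e z))\<^sup>2 + (norm z)\<^sup>2 / s) / 2) \<le> ?l (s + h) z - ?l s z" for z
    proof -
      have "0 \<le> (sqrt s * norm (e z) - norm z / sqrt s)\<^sup>2" by simp
      also have "\<dots> = s * (norm (e z))\<^sup>2 + (norm z)\<^sup>2 / s - 2 * (norm (e z) * norm z)"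
        using s by (simp add: power2_diff power_mult_distrib power_divide)
      finally have 1: "norm (e z) * norm z \<le> (s * (norm (e z))\<^sup>2 + (norm z)\<^sup>2 / s) / 2" by simp
      have "- (norm (e z) * norm z) \<le> e z \<bullet> z"
        using Cauchy_Schwarz_ineq2[of "e z" z] by simp
      then have "- ((s * (norm (e z))\<^sup>2 + (norm z)\<^sup>2 / s) / 2) \<le> e z \<bullet> z"
        using 1 by linarith
      then have "h * ((s - 1 / s) * (norm z)\<^sup>2 - (s * (norm (e z))\<^sup>2 + (norm z)\<^sup>2 / s) / 2)
          \<le> h * ((s - 1 / s) * (norm z)\<^sup>2 + e z \<bullet> z)"
        using h by (intro mult_left_mono) auto
      also have "\<dots> = posterior_mean \<pi> (s *\<^sub>R z) \<bullet> ((s + h) *\<^sub>R z - s *\<^sub>R z)"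
        by (simp add: e_def power2_norm_eq_inner inner_diff_left flip: scaleR_diff_left)
      also have "\<dots> \<le> ?l (s + h) z - ?l s z"
        using cumulant_subgradient[of "s *\<^sub>R z" "(s + h) *\<^sub>R z"] by simp
      finally show ?thesis .
    qed
    have int_lower: "integrable ?M (\<lambda>z. h * ((s - 1 / s) * (norm z)\<^sup>2 - (s * (norm (e z))\<^sup>2 + (norm z)\<^sup>2 / s) / 2))"
      using int_sq int_e by auto
    have "(LINT z|?M. h * ((s - 1 / s) * (norm z)\<^sup>2 - (s * (norm (e z))\<^sup>2 + (norm z)\<^sup>2 / s) / 2))
      \<le> (LINT z|?M. ?l (s + h) z - ?l s z)"
      by (intro integral_mono int_lower Bochner_Integration.integrable_diff int_l ptw)
    also have "\<dots> = (LINT z|?M. ?l (s + h) z) - (LINT z|?M. ?l s z)"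
      by (simp add: int_l)
    also have "(LINT z|?M. h * ((s - 1 / s) * (norm z)\<^sup>2 - (s * (norm (e z))\<^sup>2 + (norm z)\<^sup>2 / s) / 2))
      = h * ((s - 1 / s) * a - (s * (LINT z|?M. (norm (e z))\<^sup>2) + a / s) / 2)"
      using int_sq int_e by (simp add: a_def)
    finally have 1: "h * ((s - 1 / s) * a - (s * (LINT z|?M. (norm (e z))\<^sup>2) + a / s) / 2)
       \<le> (LINT z|?M. ?l (s + h) z) - (LINT z|?M. ?l s z)" .
    have "s * (LINT z|?M. (norm (e z))\<^sup>2) \<le> s * (?p / s\<^sup>2)"
      using E s by (intro mult_left_mono) auto
    then have "h * ((s - 1 / s) * a - (s * (?p / s\<^sup>2) + a / s) / 2) \<le>
       h * ((s - 1 / s) * a - (s * (LINT z|?M. (norm (e z))\<^sup>2) + a / s) / 2)"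
      using h by (intro mult_left_mono diff_left_mono divide_right_mono add_right_mono) (use E s in auto)
    also note 1
    finally have "h * ((s - 1 / s) * a - (s * (?p / s\<^sup>2) + a / s) / 2) 
       \<le> (LINT z|?M. ?l (s + h) z) - (LINT z|?M. ?l s z)" .
    moreover have "h * ((s - 1 / s) * a - (s * (?p / s\<^sup>2) + a / s) / 2) = h * s * a - h * b / s"
      using s by (simp add: b_def field_simps power2_eq_square)
    \<comment> \<open>The term \<open>h * s * a\<close> is exactly the linear part of the growth of
      \<open>s\<^sup>2 * a / 2\<close>, so besides \<open>h * b / s\<close> only the quadratic
      remainder is lost.\<close>
    moreover have "(s + h)\<^sup>2 * a / 2 = s\<^sup>2 * a / 2 + h * s * a + h\<^sup>2 * a / 2"
      by (simp add: power2_eq_square field_simps)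
    ultimately show ?thesis unfolding N_def by linarith
  qed
  have two: "1 < 2 * (2 :: real) ^ j" for j
    using one_le_power[of "2 :: real" j] by linarith
  \<comment> \<open>Each doubling of the scale costs \<open>N\<close> at most \<open>b\<close>;
    starting at 2 keeps every scale above 1.\<close>
  have lower: "N (2 * 2 ^ j) \<ge> N 2 - j * b" for j :: nat
  proof (induction j)
    case (Suc j)
    have "N (2 * (2 * 2 ^ j)) \<ge> N (2 * 2 ^ j) - b"
      by (rule growth_from_steps[OF a b two step])
    with Suc show ?case by (simp add: algebra_simps)
  qed simp
  define w where "w = measure ?M UNIV"
  have w: "w > 0" using annulus_pos by (simp add: w_def)
  \<comment> \<open>With this \<open>k\<close> the upper bound drops by \<open>w * k * ln 2\<close>
    per doubling, which exceeds \<open>b\<close>.\<close>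
  obtain k :: nat where k: "b / (w * ln 2) < k" using reals_Archimedean2 by blast
  obtain C where C: "C > 0" "\<And>y. y \<noteq> 0 \<Longrightarrow> cumulant y \<le> (norm y)\<^sup>2 / 2 + ln C - k * ln (norm y)"
    using cumulant_upper_bound[of k] by auto
  \<comment> \<open>On the annulus \<open>norm z \<ge> 1\<close>, so the logarithmic decay at
    \<open>s *\<^sub>R z\<close> is at least the decay at radius \<open>s\<close>.\<close>
  have upper: "N s \<le> w * (ln C - k * ln s)" if s: "s > 1" for s
  proof -
    have "(LINT z|?M. ?l s z - s\<^sup>2 * (norm z)\<^sup>2 / 2) \<le> (LINT z|?M. ln C - k * ln s)"
    proof (rule integral_mono_AE)
      show "integrable ?M (\<lambda>z. ?l s z - s\<^sup>2 * (norm z)\<^sup>2 / 2)" using int_l int_sq by simp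
      show "AE z in ?M. ?l s z - s\<^sup>2 * (norm z)\<^sup>2 / 2 \<le> ln C - k * ln s"
        using AE_annulus
      proof eventually_elim
        fix z :: "real^'p" assume z: "1 \<le> norm z \<and> norm z \<le> 2"
        then have "s * 1 \<le> s * norm z" using s by (intro mult_left_mono) auto
        moreover have "norm z > 0" using z by linarith
        ultimately have "ln s \<le> ln (s * norm z)" using s by (subst ln_le_cancel_iff) auto
        then have "k * ln s \<le> k * ln (s * norm z)" by (intro mult_left_mono) auto
        moreover have "z \<noteq> 0" using z by auto
        then have "?l s z \<le> (s * norm z)\<^sup>2 / 2 + ln C - k * ln (s * norm z)"
          using C(2)[of "s *\<^sub>R z"] s z by auto
        ultimately show "?l s z - s\<^sup>2 * (norm z)\<^sup>2 / 2 \<le> ln C - k * ln s"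
          by (simp add: power_mult_distrib)
      qed
    qed simp
    then show ?thesis
      by (simp add: N_def int_l int_sq w_def a_def space_annulus_measure)
  qed
  define \<gamma> where "\<gamma> = w * k * ln 2 - b"
  have \<gamma>: "\<gamma> > 0" using k w by (simp add: \<gamma>_def divide_less_eq mult_ac)
  \<comment> \<open>After this many doublings the accumulated discrepancy
    \<open>j * \<gamma>\<close> exceeds the initial distance between the two bounds.\<close>
  obtain j :: nat where j: "(w * (ln C - k * ln 2) - N 2) / \<gamma> < j" using reals_Archimedean2 by blast
  have "N 2 - j * b \<le> w * (ln C - k * ln (2 * 2 ^ j))"
    by (rule order_trans[OF lower upper[OF two]])
  also have "ln (2 * 2 ^ j) = (j + 1) * ln (2::real)"
    by (simp add: ln_mult ln_realpow algebra_simps)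
  finally have "j * \<gamma> \<le> w * (ln C - k * ln 2) - N 2"
    by (simp add: \<gamma>_def algebra_simps)
  with j \<gamma> show False by (simp add: divide_less_eq)
qed

end

section \<open>Mellin-Barnes integrals\<close>

text \<open>The integrand of \<open>\<integral>\<^sub>0\<^sup>\<infinity> x\<^bsup>z-1\<^esup> e\<^bsup>-x\<^esup> dx\<close>, with the power written through the real logarithm so that
  it is visibly measurable in both arguments.\<close>

definition gamma_kernel :: "complex \<Rightarrow> real \<Rightarrow> complex" where
  "gamma_kernel z x = of_real (indicator {0<..} x * exp (- x)) * exp ((z - 1) * of_real (ln x))"

section \<open>Euler's integral and the size of Gamma on vertical lines\<close>

lemma norm_gamma_kernel:
  "norm (gamma_kernel z x) = indicator {0<..} x * x powr (Re z - 1) * exp (- x)"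
  by (auto simp: gamma_kernel_def norm_mult powr_def split: split_indicator)

lemma gamma_kernel_eq:
  assumes "x > 0"
  shows "gamma_kernel z x = of_real x powr (z - 1) / of_real (exp x)"
proof -
  have "of_real x powr (z - 1) = exp ((z - 1) * of_real (ln x))"
    using assms by (subst powr_def) (simp add: Ln_of_real)
  moreover have "complex_of_real (exp (- x)) = inverse (of_real (exp x))"
    by (simp only: exp_minus of_real_inverse)
  ultimately show ?thesis
    using assms by (simp only: gamma_kernel_def divide_inverse) simp
qed

lemma measurable_gamma_kernel [measurable]:
  "(\<lambda>(z, x). gamma_kernel z x) \<in> borel_measurable (borel \<Otimes>\<^sub>M borel)"
  "gamma_kernel z \<in> borel_measurable borel"
  unfolding gamma_kernel_def by measurable

text \<open>Absolute integrability carries Euler's formula from the gauge integral to the Lebesgue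
  integral over \<open>lborel\<close>, where Fubini's theorem applies.\<close>

lemma has_bochner_integral_gamma_kernel:
  assumes "Re z > 0"
  shows "has_bochner_integral lborel (gamma_kernel z) (Gamma z)"
proof -
  let ?f = "\<lambda>x. of_real x powr (z - 1) / of_real (exp x) :: complex"
  have *: "indicator {0<..} x *\<^sub>R ?f x = gamma_kernel z x" for x
  proof (cases "x > 0")
    case False
    then show ?thesis by (simp add: gamma_kernel_def)
  qed (simp add: gamma_kernel_eq)
  have "integrable lebesgue (gamma_kernel z)"
    using absolutely_integrable_Gamma_integral'[OF assms] by (simp add: set_integrable_def *)
  then have int: "integrable lborel (gamma_kernel z)"
    by (simp add: integrable_completion)
  then have "set_integrable lborel {0<..} ?f"
    by (simp add: set_integrable_def *)
  from set_borel_integral_eq_integral(2)[OF this] Gamma_integral_complex'[OF assms]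
  have "(LINT x|lborel. gamma_kernel z x) = Gamma z"
    by (simp add: set_lebesgue_integral_def * integral_unique)
  with int show ?thesis by (simp add: has_bochner_integral_iff)
qed

lemma has_bochner_integral_gamma_kernel_real:
  fixes a :: real
  assumes "a > 0"
  shows "has_bochner_integral lborel (\<lambda>x. indicator {0<..} x * x powr (a - 1) * exp (- x)) (Gamma a)"
proof -
  have "of_real (indicator {0<..} x * x powr (a - 1) * exp (- x)) = gamma_kernel (of_real a) x" for x
  proof -
    have "exp ((of_real a - 1) * of_real (ln x)) = complex_of_real (exp ((a - 1) * ln x))"
      by (simp only: of_real_exp of_real_mult of_real_diff of_real_1)
    then show ?thesis
      by (simp only: gamma_kernel_def) (auto simp: powr_def split: split_indicator)
  qed
  then have *: "has_bochner_integral lborel (\<lambda>x. complex_of_real (indicator {0<..} x * x powr (a - 1) * exp (- x)))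
      (complex_of_real (Gamma a))"
    using has_bochner_integral_gamma_kernel[of "of_real a"] assms by (simp add: Gamma_complex_of_real)
  show ?thesis
    using has_bochner_integral_bounded_linear[OF bounded_linear_Re *] by simp
qed

text \<open>The triangle inequality in Euler's integral, because the modulus of the kernel depends
  on \<open>z\<close> only through \<open>Re z\<close>.\<close>

lemma norm_Gamma_le:
  assumes "Re z > 0"
  shows "norm (Gamma z) \<le> Gamma (Re z)"
proof -
  have "norm (LINT x|lborel. gamma_kernel z x) \<le> (LINT x|lborel. norm (gamma_kernel z x))"
    by (rule integral_norm_bound)
  then show ?thesis
    using has_bochner_integral_gamma_kernel[OF assms] has_bochner_integral_gamma_kernel_real[of "Re z"] assms
    by (simp add: norm_gamma_kernel has_bochner_integral_iff)
qed

lemma not_nonpos_Ints_if_Re_pos: "Re z > 0 \<Longrightarrow> z \<notin> \<int>\<^sub>\<le>\<^sub>0"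
  by (auto elim!: nonpos_Ints_cases)

lemma measurable_Gamma_vertical:
  assumes "a > 0"
  shows "(\<lambda>t. Gamma (Complex a t)) \<in> borel_measurable borel"
proof (rule borel_measurable_continuous_onI)
  show "continuous_on UNIV (\<lambda>t. Gamma (Complex a t))"
    using assms unfolding Complex_eq
    by (intro continuous_on_compose2[OF continuous_on_Gamma[of "{z. Re z > 0}"]] continuous_intros)
       (auto dest: not_nonpos_Ints_if_Re_pos)
qed

text \<open>The decay comes from applying the functional equation twice.\<close>

lemma norm_Gamma_vertical_le:
  assumes a: "a > 0"
  shows "norm (Gamma (Complex a t)) \<le> Gamma (a + 2) * (1 + 1 / a\<^sup>2) / (1 + t\<^sup>2)"
proof -
  define z where "z = Complex a t"
  define n where "n = norm (Gamma z)"
  have z: "Re z > 0" "Re (z + 1) > 0" "Re (z + 1 + 1) = a + 2" using a by (simp_all add: z_def)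
  have "Gamma (z + 1 + 1) = (z + 1) * (z * Gamma z)"
    by (simp only: Gamma_plus1[OF not_nonpos_Ints_if_Re_pos[OF z(1)]] Gamma_plus1[OF not_nonpos_Ints_if_Re_pos[OF z(2)]])
  moreover have "norm (Gamma (z + 1 + 1)) \<le> Gamma (a + 2)"
    using norm_Gamma_le[of "z + 1 + 1", unfolded z(3)] a by linarith
  ultimately have "norm (z + 1) * (norm z * n) \<le> Gamma (a + 2)"
    by (simp only: norm_mult n_def)
  moreover have "norm z \<le> norm (z + 1)"
  proof -
    have "a\<^sup>2 \<le> (a + 1)\<^sup>2" using a by (intro power_mono) auto
    then show ?thesis by (simp add: cmod_def z_def)
  qed
  then have "norm z * (norm z * n) \<le> norm (z + 1) * (norm z * n)"
    by (rule mult_right_mono) (simp add: n_def)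
  ultimately have "norm z * (norm z * n) \<le> Gamma (a + 2)" by linarith
  moreover have "norm z * norm z = a\<^sup>2 + t\<^sup>2"
    using cmod_power2[of z] by (simp only: power2_eq_square z_def complex.sel)
  ultimately have 1: "(a\<^sup>2 + t\<^sup>2) * n \<le> Gamma (a + 2)" by (simp only: mult.assoc[symmetric])
  \<comment> \<open>This trades \<open>a\<^sup>2 + t\<^sup>2\<close> for
    \<open>1 + t\<^sup>2\<close>, so that the integrable majorant has the same shape for every
    \<open>a\<close>.\<close>
  have "(1 + 1 / a\<^sup>2) * (a\<^sup>2 + t\<^sup>2) = a\<^sup>2 + t\<^sup>2 + 1 + t\<^sup>2 / a\<^sup>2"
    using a by (simp add: distrib_left distrib_right)
  moreover have "t\<^sup>2 / a\<^sup>2 \<ge> 0" "a\<^sup>2 \<ge> 0" by simp_all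
  ultimately have "1 + t\<^sup>2 \<le> (1 + 1 / a\<^sup>2) * (a\<^sup>2 + t\<^sup>2)" by linarith
  then have "n * (1 + t\<^sup>2) \<le> n * ((1 + 1 / a\<^sup>2) * (a\<^sup>2 + t\<^sup>2))"
    by (rule mult_left_mono) (simp add: n_def)
  also have "\<dots> = ((a\<^sup>2 + t\<^sup>2) * n) * (1 + 1 / a\<^sup>2)" by (simp only: mult_ac)
  also have "\<dots> \<le> Gamma (a + 2) * (1 + 1 / a\<^sup>2)"
    using 1 by (rule mult_right_mono) simp
  finally have 2: "n * (1 + t\<^sup>2) \<le> Gamma (a + 2) * (1 + 1 / a\<^sup>2)" .
  have "1 + t\<^sup>2 > 0" by (simp add: add_pos_nonneg)
  from pos_le_divide_eq[OF this] 2 show ?thesis unfolding n_def z_def by blast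
qed

lemma integrable_Gamma_vertical:
  assumes a: "a > 0"
  shows "integrable lborel (\<lambda>t. Gamma (Complex a t))"
proof (rule Bochner_Integration.integrable_bound)
  have "set_integrable lborel UNIV (\<lambda>t :: real. inverse (1 + t\<^sup>2))"
    using integrable_inverse_1_plus_square by simp
  then have "integrable lborel (\<lambda>t :: real. inverse (1 + t\<^sup>2))"
    by (simp add: set_integrable_def)
  then show "integrable lborel (\<lambda>t. Gamma (a + 2) * (1 + 1 / a\<^sup>2) * inverse (1 + t\<^sup>2))"
    by (rule integrable_mult_right)
  show "(\<lambda>t. Gamma (Complex a t)) \<in> borel_measurable lborel"
    using measurable_Gamma_vertical[OF a] by simp
  show "AE t in lborel. norm (Gamma (Complex a t)) \<le> norm (Gamma (a + 2) * (1 + 1 / a\<^sup>2) * inverse (1 + t\<^sup>2))"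
    using order_trans[OF norm_Gamma_vertical_le[OF a] abs_ge_self]
    by (intro AE_I2) (simp only: real_norm_def divide_inverse)
qed

section \<open>Fubini, Fourier and substitution tools, and Mellin inversion of Gamma\<close>

lemma integrable_lborel_pair_bound:
  fixes f :: "real \<times> real \<Rightarrow> complex" and u v :: "real \<Rightarrow> real"
  assumes [measurable]: "f \<in> borel_measurable (borel \<Otimes>\<^sub>M borel)"
    and u: "integrable lborel u" and v: "integrable lborel v"
    and le: "\<And>x t. norm (f (x, t)) \<le> u x * v t"
  shows "integrable (lborel \<Otimes>\<^sub>M lborel) f"
proof (rule Bochner_Integration.integrable_bound)
  have [measurable]: "u \<in> borel_measurable borel" "v \<in> borel_measurable borel"
    using u v by (auto dest: borel_measurable_integrable)
  show "integrable (lborel \<Otimes>\<^sub>M lborel) (\<lambda>(x, t). u x * v t)"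
    by (rule lborel_pair.Fubini_integrable) (use u v in \<open>auto simp: abs_mult\<close>)
  show "AE p in lborel \<Otimes>\<^sub>M lborel. norm (f p) \<le> norm (case p of (x, t) \<Rightarrow> u x * v t)"
  proof (rule AE_I2)
    fix p :: "real \<times> real"
    show "norm (f p) \<le> norm (case p of (x, t) \<Rightarrow> u x * v t)"
      using le[of "fst p" "snd p"] by (simp add: case_prod_unfold)
  qed
qed simp

text \<open>The characteristic function of the standard normal distribution at \<open>v / s\<close>,
  rescaled by the substitution \<open>t \<mapsto> s * t\<close>.\<close>

lemma integral_exp_minus_square_iexp:
  assumes s: "s > 0"
  shows "(LINT t|lborel. of_real (exp (- (s * t)\<^sup>2 / 2)) * exp (\<i> * of_real (t * v)))
    = of_real (sqrt (2 * pi) / s * exp (- (v / s)\<^sup>2 / 2))"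
proof -
  let ?f = "\<lambda>t. of_real (exp (- t\<^sup>2 / 2)) * exp (\<i> * of_real (t * (v / s))) :: complex"
  have "char std_normal_distribution (v / s)
     = (LINT t|lborel. std_normal_density t *\<^sub>R exp (\<i> * of_real (v / s * t)))"
    unfolding char_def by (subst integral_density) (auto simp: normal_density_nonneg)
  also have "\<dots> = (LINT t|lborel. of_real (1 / sqrt (2 * pi)) * ?f t)"
    by (intro Bochner_Integration.integral_cong) (auto simp: std_normal_density_def scaleR_conv_of_real mult_ac)
  also have "\<dots> = of_real (1 / sqrt (2 * pi)) * (LINT t|lborel. ?f t)"
    by simp
  finally have 1: "(LINT t|lborel. ?f t) = of_real (sqrt (2 * pi) * exp (- (v / s)\<^sup>2 / 2))"
    unfolding char_std_normal_distribution by (simp add: field_simps)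
  have "(LINT t|lborel. ?f t) = \<bar>s\<bar> *\<^sub>R (LINT t|lborel. ?f (0 + s * t))"
    using s by (intro lborel_integral_real_affine) simp
  also have "(LINT t|lborel. ?f (0 + s * t)) = (LINT t|lborel. of_real (exp (- (s * t)\<^sup>2 / 2)) * exp (\<i> * of_real (t * v)))"
    using s by (intro Bochner_Integration.integral_cong) (auto simp: mult_ac)
  finally show ?thesis
    using 1 s by (simp add: scaleR_conv_of_real field_simps)
qed

text \<open>Supplies the constant majorant for dominated convergence in \<open>Cahen_Mellin\<close>.
  The power is at most 1 for \<open>y \<le> 1\<close>; beyond that an integer power takes over,
  which one term of the exponential series controls.\<close>

lemma powr_mult_exp_minus_le:
  fixes c y z :: real
  assumes "c > 0" "y > 0" "z > 0" and k: "c \<le> real k"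
  shows "y powr c * exp (- z * y) \<le> 1 + fact k / z ^ k"
proof -
  have "y powr c \<le> 1 + y ^ k"
  proof (cases "y \<le> 1")
    case True
    then have "y powr c \<le> 1 powr c" using assms by (intro powr_mono2) auto
    then show ?thesis using assms by (simp add: add_increasing2)
  next
    case False
    then have "y powr c \<le> y powr real k" using k by (intro powr_mono) auto
    then show ?thesis using assms by (simp add: powr_realpow)
  qed
  then have "y powr c * exp (- z * y) \<le> (1 + y ^ k) * exp (- z * y)"
    by (rule mult_right_mono) simp
  also have "\<dots> = exp (- z * y) + y ^ k * exp (- z * y)" by (simp add: distrib_right)
  also have "\<dots> \<le> 1 + fact k / z ^ k"
  proof (rule add_mono)
    show "exp (- z * y) \<le> 1" using assms by simp
    have "(z * y) ^ k \<le> fact k * exp (z * y)"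
      using assms by (intro power_le_fact_exp) simp
    then have "(z * y) ^ k * exp (- z * y) \<le> fact k * exp (z * y) * exp (- z * y)"
      by (rule mult_right_mono) simp
    also have "\<dots> = fact k" by (simp add: mult.assoc flip: exp_add)
    finally have "(y ^ k * exp (- z * y)) * z ^ k \<le> fact k"
      by (simp add: power_mult_distrib mult_ac)
    then show "y ^ k * exp (- z * y) \<le> fact k / z ^ k"
      using assms by (subst pos_le_divide_eq) auto
  qed
  finally show ?thesis .
qed

text \<open>In logarithmic coordinates centred at \<open>z\<close> and scaled by \<open>s\<close>, a
  narrow Gaussian in \<open>ln x - ln z\<close> becomes a standard Gaussian in \<open>w\<close>. The
  change of variables is performed on absolutely integrable functions and then carried back to
  \<open>lborel\<close>.\<close>

lemma integral_exp_substitution: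
  fixes F :: "real \<Rightarrow> real"
  assumes [measurable]: "F \<in> borel_measurable borel"
    and int: "integrable lborel (\<lambda>x. indicator {0<..} x * F x)" and z: "z > 0" and s: "s > 0"
  shows "(LINT x|lborel. indicator {0<..} x * F x) = (LINT w|lborel. s * z * exp (s * w) * F (z * exp (s * w)))"
proof -
  let ?g = "\<lambda>w. z * exp (s * w)" and ?h = "\<lambda>w. s * z * exp (s * w)"
  have range: "range ?g = {0<..}"
  proof (intro equalityI subsetI)
    fix y :: real assume "y \<in> {0<..}"
    then have "y = ?g (ln (y / z) / s)" using z s by simp
    then show "y \<in> range ?g" by (rule range_eqI)
  qed (use z in auto)
  have int': "set_integrable lborel {0<..} F"
    using int by (simp add: set_integrable_def)
  then have "F absolutely_integrable_on {0<..}"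
    unfolding set_integrable_def by (subst integrable_completion) auto
  then have "F absolutely_integrable_on range ?g \<and> integral (range ?g) F = integral {0<..} F"
    by (simp add: range)
  moreover have "(?g has_field_derivative ?h x) (at x within UNIV)" for x
    by (auto intro!: derivative_eq_intros)
  moreover have "inj ?g" using z s by (auto simp: inj_on_def)
  ultimately have abs: "(\<lambda>w. \<bar>?h w\<bar> * F (?g w)) absolutely_integrable_on UNIV \<and>
     integral UNIV (\<lambda>w. \<bar>?h w\<bar> * F (?g w)) = integral {0<..} F"
    by (subst has_absolute_integral_change_of_variables_1') auto
  then have "set_integrable lborel UNIV (\<lambda>w. \<bar>?h w\<bar> * F (?g w))"
    unfolding set_integrable_def by (subst (asm) integrable_completion) auto
  from set_borel_integral_eq_integral(2)[OF this] abs
  have "(LINT w|lborel. \<bar>?h w\<bar> * F (?g w)) = integral {0<..} F"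
    by (simp add: set_lebesgue_integral_def)
  also have "\<dots> = (LINT x|lborel. indicator {0<..} x * F x)"
    using set_borel_integral_eq_integral(2)[OF int'] by (simp add: set_lebesgue_integral_def)
  finally show ?thesis using z s by (simp add: abs_mult)
qed

text \<open>Separating \<open>c\<close> from \<open>b\<close> moves a power of \<open>x\<close> into
  the second exponential: for \<open>l = ln z\<close> the new argument is \<open>ln (z / x)\<close>,
  as a multiplicative convolution requires.\<close>

lemma gamma_kernel_mult_exp:
  assumes "x > 0"
  shows "gamma_kernel (Complex (c + b) t) x * exp (- Complex c t * of_real l)
    = of_real (x powr (b - 1) * exp (- x)) * exp (- Complex c t * of_real (l - ln x))"
proof -
  have "(Complex (c + b) t - 1) * of_real (ln x) + - Complex c t * of_real l
     = of_real ((b - 1) * ln x) + - Complex c t * of_real (l - ln x)"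
    by (simp add: complex_eq_iff algebra_simps)
  then have "exp ((Complex (c + b) t - 1) * of_real (ln x)) * exp (- Complex c t * of_real l)
     = of_real (exp ((b - 1) * ln x)) * exp (- Complex c t * of_real (l - ln x))"
    by (simp only: exp_add[symmetric] of_real_exp)
  moreover have "exp ((b - 1) * ln x) = x powr (b - 1)"
    using assms by (simp add: powr_def)
  ultimately show ?thesis
    using assms by (simp add: gamma_kernel_def mult_ac)
qed

lemma norm_exp_vertical: "norm (exp (- Complex c t * of_real l)) = exp (- c * l)"
  by simp

lemma Complex_measurable [measurable]: "(\<lambda>t. Complex c t) \<in> borel_measurable borel"
  unfolding Complex_eq by measurable

text \<open>Fourier inversion with a Gaussian summability factor \<open>exp (- (s t)\<^sup>2 / 2)\<close>, \<open>s \<rightarrow> 0\<close>.\<close>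

lemma Cahen_Mellin:
  assumes c: "c > 0" and z: "z > 0"
  shows "(LINT t|lborel. Gamma (Complex c t) * exp (- Complex c t * of_real (ln z))) = of_real (2 * pi * exp (- z))"
proof -
  define G where "G t = Gamma (Complex c t) * exp (- Complex c t * of_real (ln z))" for t
  define L where "L s = (LINT t|lborel. of_real (exp (- (s * t)\<^sup>2 / 2)) * G t)" for s
  \<comment> \<open>The regularised integral will become \<open>2 * pi\<close> times a Gaussian
    average of \<open>H (s * w)\<close>; as \<open>s\<close> tends to 0 only
    \<open>H 0 = exp (- z)\<close> survives.\<close>
  define H where "H v = exp (c * v) * exp (- z * exp v)" for v
  have [measurable]: "(\<lambda>t. Gamma (Complex c t)) \<in> borel_measurable borel"
    by (rule measurable_Gamma_vertical[OF c])
  have [measurable]: "G \<in> borel_measurable borel" unfolding G_def by measurable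
  have [measurable]: "H \<in> borel_measurable borel" unfolding H_def by measurable
  have normG: "norm (G t) = norm (Gamma (Complex c t)) * exp (- c * ln z)" for t
    by (simp only: G_def norm_mult norm_exp_vertical)
  have intG: "integrable lborel G"
    by (rule Bochner_Integration.integrable_bound[where f="\<lambda>t. norm (Gamma (Complex c t)) * exp (- c * ln z)"])
       (use integrable_Gamma_vertical[OF c] in \<open>auto simp: normG\<close>)
  have lim1: "(\<lambda>n. L (1 / real (Suc n))) \<longlonglongrightarrow> (LINT t|lborel. G t)"
    unfolding L_def
  proof (rule integral_dominated_convergence[where w="\<lambda>t. norm (G t)"])
    show "AE t in lborel. (\<lambda>n. of_real (exp (- (1 / real (Suc n) * t)\<^sup>2 / 2)) * G t) \<longlonglongrightarrow> G t"
    proof (rule AE_I2)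
      fix t
      have "(\<lambda>n. of_real (exp (- (1 / real (Suc n) * t)\<^sup>2 / 2)) * G t) \<longlonglongrightarrow> of_real (exp (- (0 * t)\<^sup>2 / 2)) * G t"
        by (intro tendsto_intros LIMSEQ_Suc[OF lim_1_over_n]) auto
      then show "(\<lambda>n. of_real (exp (- (1 / real (Suc n) * t)\<^sup>2 / 2)) * G t) \<longlonglongrightarrow> G t" by simp
    qed
    show "AE t in lborel. norm (of_real (exp (- (1 / real (Suc n) * t)\<^sup>2 / 2)) * G t) \<le> norm (G t)" for n
      by (rule AE_I2) (simp only: norm_mult norm_of_real, rule mult_left_le_one_le, auto)
  qed (use intG in auto)
  have L: "L s = of_real (LINT w|lborel. 2 * pi * std_normal_density w * H (s * w))" if s: "s > 0" for s
  proof -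
    define f where "f = (\<lambda>(x, t). of_real (exp (- (s * t)\<^sup>2 / 2)) *
       (gamma_kernel (Complex c t) x * exp (- Complex c t * of_real (ln z))))"
    define F where "F x = x powr (c - 1) * exp (- x) * exp (- c * ln z) *
       (sqrt (2 * pi) / s * exp (- ((ln x - ln z) / s)\<^sup>2 / 2))" for x
    have [measurable]: "f \<in> borel_measurable (borel \<Otimes>\<^sub>M borel)" unfolding f_def by measurable
    have [measurable]: "F \<in> borel_measurable borel" unfolding F_def by measurable
    have int_exp: "integrable lborel (\<lambda>t. exp (- (s * t)\<^sup>2 / 2))"
    proof -
      have "integrable lborel (\<lambda>t. std_normal_density (0 + s * t))"
        using s by (intro lborel_integrable_real_affine integrable_normal_density) auto
      then have "integrable lborel (\<lambda>t. sqrt (2 * pi) * std_normal_density (0 + s * t))"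
        by simp
      then show ?thesis by (simp add: std_normal_density_def)
    qed
    \<comment> \<open>The modulus of the kernel does not depend on \<open>t\<close>, so
      integrability in \<open>t\<close> rests on the Gaussian factor; hence the regularisation
      before the order of integration is exchanged.\<close>
    have int_f: "integrable (lborel \<Otimes>\<^sub>M lborel) f"
    proof (rule integrable_lborel_pair_bound)
      show "integrable lborel (\<lambda>x. indicator {0<..} x * x powr (c - 1) * exp (- x) * exp (- c * ln z))"
        using has_bochner_integral_gamma_kernel_real[OF c] by (intro integrable_mult_left) (simp add: has_bochner_integral_iff)
      show "norm (f (x, t)) \<le> indicator {0<..} x * x powr (c - 1) * exp (- x) * exp (- c * ln z) * exp (- (s * t)\<^sup>2 / 2)" for x t
        unfolding f_def prod.case norm_mult norm_gamma_kernel norm_exp_vertical by (simp add: mult_ac)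
    qed (use int_exp in auto)
    have "L s = (LINT t|lborel. LINT x|lborel. f (x, t))"
      using has_bochner_integral_gamma_kernel[of "Complex c t" for t] c
      by (simp add: L_def f_def G_def has_bochner_integral_iff)
    also have "\<dots> = (LINT x|lborel. LINT t|lborel. f (x, t))"
      using lborel_pair.Fubini_integral[of "\<lambda>x t. f (x, t)"] int_f by simp
    also have "\<dots> = (LINT x|lborel. of_real (indicator {0<..} x * F x))"
    proof (intro Bochner_Integration.integral_cong refl)
      fix x :: real
      show "(LINT t|lborel. f (x, t)) = of_real (indicator {0<..} x * F x)"
      proof (cases "x > 0")
        case True
        have "f (x, t) = of_real (x powr (c - 1) * exp (- x) * exp (- c * ln z)) *
           (of_real (exp (- (s * t)\<^sup>2 / 2)) * exp (\<i> * of_real (t * (ln x - ln z))))" for t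
        proof -
          have *: "- Complex c t * of_real (ln z - ln x) = of_real (c * ln x) + (of_real (- c * ln z) + \<i> * of_real (t * (ln x - ln z)))"
            by (simp add: complex_eq_iff algebra_simps)
          have "gamma_kernel (Complex c t) x * exp (- Complex c t * of_real (ln z))
             = of_real (x powr (0 - 1) * exp (- x)) * exp (- Complex c t * of_real (ln z - ln x))"
            using gamma_kernel_mult_exp[OF True, of c 0 t "ln z"] by simp
          also have "\<dots> = of_real ((x powr (0 - 1) * exp (c * ln x)) * exp (- x) * exp (- c * ln z)) * exp (\<i> * of_real (t * (ln x - ln z)))"
            unfolding * exp_add by (simp only: of_real_mult of_real_exp mult_ac)
          also have "x powr (0 - 1) * exp (c * ln x) = x powr (c - 1)"
            using True by (simp add: powr_def flip: exp_add) (simp add: algebra_simps)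
          finally show ?thesis by (simp add: f_def mult_ac)
        qed
        then have "(LINT t|lborel. f (x, t)) = of_real (F x)"
          by (simp only: integral_mult_right_zero integral_exp_minus_square_iexp[OF s]) (simp only: F_def of_real_mult)
        then show ?thesis using True by simp
      qed (simp add: f_def gamma_kernel_def)
    qed
    also have "\<dots> = of_real (LINT x|lborel. indicator {0<..} x * F x)"
      by (rule integral_complex_of_real)
    also have "(LINT x|lborel. indicator {0<..} x * F x) = (LINT w|lborel. s * z * exp (s * w) * F (z * exp (s * w)))"
    proof (rule integral_exp_substitution[OF _ _ z s])
      show "integrable lborel (\<lambda>x. indicator {0<..} x * F x)"
      proof (rule Bochner_Integration.integrable_bound[where f="\<lambda>x. (indicator {0<..} x * x powr (c - 1) * exp (- x)) * (exp (- c * ln z) * (sqrt (2 * pi) / s))"])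
        show "integrable lborel (\<lambda>x. indicator {0<..} x * x powr (c - 1) * exp (- x) * (exp (- c * ln z) * (sqrt (2 * pi) / s)))"
          using has_bochner_integral_gamma_kernel_real[OF c] by (intro integrable_mult_left) (simp add: has_bochner_integral_iff)
        show "AE x in lborel. norm (indicator {0<..} x * F x) \<le>
            norm ((indicator {0<..} x * x powr (c - 1) * exp (- x)) * (exp (- c * ln z) * (sqrt (2 * pi) / s)))"
          using s by (intro AE_I2) (auto simp: F_def abs_mult intro!: mult_left_mono divide_right_mono split: split_indicator)
      qed simp
    qed simp
    also have "\<dots> = (LINT w|lborel. 2 * pi * std_normal_density w * H (s * w))"
    proof (intro Bochner_Integration.integral_cong refl)
      fix w :: real
      define x where "x = z * exp (s * w)"
      have x: "x > 0" using z by (simp add: x_def)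
      have lnx: "ln x = ln z + s * w" using z by (simp add: x_def ln_mult)
      have "x * (x powr (c - 1) * exp (- c * ln z)) = exp (ln x + (c - 1) * ln x + - c * ln z)"
      proof -
        have "exp (ln x + (c - 1) * ln x + - c * ln z) = exp (ln x) * exp ((c - 1) * ln x) * exp (- c * ln z)"
          by (simp only: exp_add)
        then show ?thesis using x by (simp add: powr_def)
      qed
      also have "ln x + (c - 1) * ln x + - c * ln z = c * (s * w)" by (simp add: lnx algebra_simps)
      finally have 1: "x * (x powr (c - 1) * exp (- c * ln z)) = exp (c * (s * w))" .
      have 2: "(ln x - ln z) / s = w" using s by (simp add: lnx)
      have "s * z * exp (s * w) * F (z * exp (s * w)) = s * x * F x" by (simp add: x_def)
      also have "\<dots> = (x * (x powr (c - 1) * exp (- c * ln z))) * exp (- x) * sqrt (2 * pi) * exp (- w\<^sup>2 / 2)"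
        unfolding F_def 2 using s by simp
      also have "\<dots> = exp (c * (s * w)) * exp (- x) * (sqrt (2 * pi) * exp (- w\<^sup>2 / 2))"
        unfolding 1 by simp
      also have "sqrt (2 * pi) * exp (- w\<^sup>2 / 2) = 2 * pi * std_normal_density w"
        by (simp add: std_normal_density_def real_div_sqrt field_simps flip: real_sqrt_mult)
      finally show "s * z * exp (s * w) * F (z * exp (s * w)) = 2 * pi * std_normal_density w * H (s * w)"
        by (simp add: H_def x_def)
    qed
    finally show ?thesis .
  qed
  obtain k :: nat where k: "c \<le> real k" using real_arch_simple by blast
  define M where "M = 1 + fact k / z ^ k"
  have H_le: "norm (H v) \<le> M" for v
    using powr_mult_exp_minus_le[OF c exp_gt_zero z k, of v] by (simp add: H_def M_def powr_def)
  have "(\<lambda>n. LINT w|lborel. 2 * pi * std_normal_density w * H (1 / real (Suc n) * w))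
     \<longlonglongrightarrow> (LINT w|lborel. 2 * pi * std_normal_density w * H 0)"
  proof (rule integral_dominated_convergence[where w="\<lambda>w. 2 * pi * std_normal_density w * M"])
    have "isCont H 0" unfolding H_def by (intro continuous_intros)
    then show "AE w in lborel. (\<lambda>n. 2 * pi * std_normal_density w * H (1 / real (Suc n) * w))
        \<longlonglongrightarrow> 2 * pi * std_normal_density w * H 0"
    proof (intro AE_I2 tendsto_intros)
      fix w :: real assume H: "isCont H 0"
      have "(\<lambda>n. 1 / real (Suc n) * w) \<longlonglongrightarrow> 0 * w"
        by (intro tendsto_intros LIMSEQ_Suc[OF lim_1_over_n])
      then show "(\<lambda>n. H (1 / real (Suc n) * w)) \<longlonglongrightarrow> H 0"
        using H by (intro isCont_tendsto_compose[of 0 H]) simp_all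
    qed
    show "AE w in lborel. norm (2 * pi * std_normal_density w * H (1 / real (Suc n) * w)) \<le> 2 * pi * std_normal_density w * M" for n
      using H_le by (intro AE_I2) (auto simp: abs_mult intro!: mult_left_mono)
  qed (auto intro: integrable_normal_density)
  then have "(\<lambda>n. complex_of_real (LINT w|lborel. 2 * pi * std_normal_density w * H (1 / real (Suc n) * w)))
     \<longlonglongrightarrow> of_real (LINT w|lborel. 2 * pi * std_normal_density w * H 0)"
    by (rule tendsto_of_real)
  then have "(\<lambda>n. L (1 / real (Suc n))) \<longlonglongrightarrow> of_real (LINT w|lborel. 2 * pi * std_normal_density w * H 0)"
    by (simp add: L)
  with lim1 have "(LINT t|lborel. G t) = of_real (LINT w|lborel. 2 * pi * std_normal_density w * H 0)"
    by (rule LIMSEQ_unique)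
  then show ?thesis by (simp add: G_def H_def)
qed

text \<open>The Meijer function \<open>G(z | 0, b\<^sub>1, \<dots>, b\<^sub>m)\<close> as an iterated multiplicative convolution of the
  functions \<open>x\<^bsup>b\<^esup> e\<^bsup>-x\<^esup>\<close> with \<open>e\<^bsup>-z\<^esup>\<close>.\<close>

primrec gamma_conv :: "real list \<Rightarrow> real \<Rightarrow> real" where
  "gamma_conv [] z = exp (- z)"
| "gamma_conv (b # bs) z =
     (LINT x|lborel. indicator {0<..} x * (x powr (b - 1) * exp (- x)) * gamma_conv bs (z / x))"

section \<open>Mellin transforms of the iterated convolutions\<close>

lemma measurable_gamma_conv [measurable]: "gamma_conv bs \<in> borel_measurable borel"
proof (induction bs)
  case Nil
  then show ?case by simp
next
  case (Cons b bs)
  note [measurable] = Cons.IH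
  show ?case unfolding gamma_conv.simps[abs_def] by measurable
qed

lemma gamma_conv_nonneg: "gamma_conv bs z \<ge> 0"
  by (induction bs arbitrary: z) (auto intro!: Bochner_Integration.integral_nonneg)

text \<open>The Mellin transform of \<open>gamma_conv bs\<close> at \<open>Complex c t\<close>; the
  separate first factor belongs to the parameter 0, that is, to \<open>exp (- z)\<close>.\<close>

definition gamma_prod :: "real \<Rightarrow> real list \<Rightarrow> real \<Rightarrow> complex" where
  "gamma_prod c bs t = Gamma (Complex c t) * (\<Prod>b\<leftarrow>bs. Gamma (Complex (c + b) t))"

lemma gamma_prod_Cons: "gamma_prod c (b # bs) t = gamma_prod c bs t * Gamma (Complex (c + b) t)"
  by (simp add: gamma_prod_def)

text \<open>The Gamma factor of parameter 0 is integrable along the line, and each further factor is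
  bounded on it.\<close>

lemma integrable_gamma_prod:
  assumes "c > 0" "\<And>b. b \<in> set bs \<Longrightarrow> c + b > 0"
  shows "integrable lborel (gamma_prod c bs)"
  using assms(2)
proof (induction bs)
  case Nil
  then show ?case using integrable_Gamma_vertical[OF assms(1)] by (simp add: gamma_prod_def[abs_def])
next
  case (Cons b bs)
  then have int: "integrable lborel (gamma_prod c bs)" and b: "c + b > 0" by auto
  then have [measurable]: "gamma_prod c bs \<in> borel_measurable borel"
    by (auto dest: borel_measurable_integrable)
  note [measurable] = measurable_Gamma_vertical[OF b]
  show ?case
  proof (rule Bochner_Integration.integrable_bound)
    show "integrable lborel (\<lambda>t. norm (gamma_prod c bs t) * Gamma (c + b))"
      using int by simp
    have "norm (gamma_prod c (b # bs) t) \<le> norm (gamma_prod c bs t) * Gamma (c + b)" for t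
      unfolding gamma_prod_Cons norm_mult
      using norm_Gamma_le[of "Complex (c + b) t"] b by (intro mult_left_mono) auto
    from order_trans[OF this abs_ge_self]
    show "AE t in lborel. norm (gamma_prod c (b # bs) t) \<le> norm (norm (gamma_prod c bs t) * Gamma (c + b))"
      by (intro AE_I2) (simp only: real_norm_def)
    show "gamma_prod c (b # bs) \<in> borel_measurable lborel"
      unfolding gamma_prod_Cons[abs_def] by measurable
  qed
qed

text \<open>The new Gamma factor is written as Euler's integral and the order of integration
  exchanged; the inner integral is then \<open>IH\<close> at \<open>z / x\<close>. Integrability of
  the convolution integrand is a by-product of Fubini's theorem, and having \<open>IH\<close> as a
  premise makes it available outside the induction too.\<close>

lemma gamma_conv_step:
  assumes c: "c > 0" "c + b > 0" "\<And>b. b \<in> set bs \<Longrightarrow> c + b > 0" and z: "z > 0"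
    and IH: "\<And>z. z > 0 \<Longrightarrow> (LINT t|lborel. gamma_prod c bs t * exp (- Complex c t * of_real (ln z)))
      = of_real (2 * pi * gamma_conv bs z)"
  shows "integrable lborel (\<lambda>x. indicator {0<..} x * (x powr (b - 1) * exp (- x)) * gamma_conv bs (z / x))"
    and "(LINT t|lborel. gamma_prod c (b # bs) t * exp (- Complex c t * of_real (ln z)))
      = of_real (2 * pi * gamma_conv (b # bs) z)"
proof -
  let ?V = "gamma_prod c bs"
  let ?J = "\<lambda>x. indicator {0<..} x * (x powr (b - 1) * exp (- x)) * gamma_conv bs (z / x)"
  note intV = integrable_gamma_prod[of c bs, OF c(1,3)]
  have [measurable]: "?V \<in> borel_measurable borel"
    using intV by (auto dest: borel_measurable_integrable)
  define f where "f = (\<lambda>(x, t). ?V t * (gamma_kernel (Complex (c + b) t) x * exp (- Complex c t * of_real (ln z))))"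
  have [measurable]: "f \<in> borel_measurable (borel \<Otimes>\<^sub>M borel)" unfolding f_def by measurable
  have int_f: "integrable (lborel \<Otimes>\<^sub>M lborel) f"
  proof (rule integrable_lborel_pair_bound)
    show "integrable lborel (\<lambda>x. indicator {0<..} x * x powr (c + b - 1) * exp (- x) * exp (- c * ln z))"
      using has_bochner_integral_gamma_kernel_real[OF c(2)] by (intro integrable_mult_left) (simp add: has_bochner_integral_iff)
    show "norm (f (x, t)) \<le> indicator {0<..} x * x powr (c + b - 1) * exp (- x) * exp (- c * ln z) * norm (?V t)" for x t
      unfolding f_def prod.case norm_mult norm_gamma_kernel norm_exp_vertical by (simp add: mult_ac)
  qed (use intV in auto)
  have inner: "(LINT t|lborel. f (x, t)) = of_real (2 * pi * ?J x)" for x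
  proof (cases "x > 0")
    case True
    have "f (x, t) = of_real (x powr (b - 1) * exp (- x)) * (?V t * exp (- Complex c t * of_real (ln (z / x))))" for t
      unfolding f_def prod.case gamma_kernel_mult_exp[OF True] using True z by (simp add: ln_div mult_ac)
    then have "(LINT t|lborel. f (x, t)) = of_real (x powr (b - 1) * exp (- x)) * of_real (2 * pi * gamma_conv bs (z / x))"
      using IH[of "z / x"] True z by (simp only: integral_mult_right_zero divide_pos_pos)
    then show ?thesis using True by simp
  qed (simp add: f_def gamma_kernel_def)
  have "integrable lborel (\<lambda>x. LINT t|lborel. f (x, t))"
    using lborel_pair.integrable_fst'[OF int_f] .
  then have "integrable lborel (\<lambda>x. Re (of_real (2 * pi * ?J x)))"
    unfolding inner by (rule integrable_Re)
  then have "integrable lborel (\<lambda>x. 1 / (2 * pi) * (2 * pi * ?J x))"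
    unfolding Re_complex_of_real by (rule integrable_mult_right)
  then show int_J: "integrable lborel ?J" by simp
  have "(LINT t|lborel. gamma_prod c (b # bs) t * exp (- Complex c t * of_real (ln z)))
     = (LINT t|lborel. LINT x|lborel. f (x, t))"
    using has_bochner_integral_gamma_kernel[of "Complex (c + b) t" for t] c(2)
    by (simp add: f_def gamma_prod_Cons has_bochner_integral_iff mult.assoc)
  also have "\<dots> = (LINT x|lborel. LINT t|lborel. f (x, t))"
    using lborel_pair.Fubini_integral[of "\<lambda>x t. f (x, t)"] int_f by simp
  also have "\<dots> = of_real (LINT x|lborel. 2 * pi * ?J x)"
    unfolding inner by (rule integral_complex_of_real)
  also have "(LINT x|lborel. 2 * pi * ?J x) = 2 * pi * gamma_conv (b # bs) z"
    unfolding gamma_conv.simps by (rule integral_mult_right_zero)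
  finally show "(LINT t|lborel. gamma_prod c (b # bs) t * exp (- Complex c t * of_real (ln z)))
      = of_real (2 * pi * gamma_conv (b # bs) z)" .
qed

lemma integral_gamma_prod:
  assumes "c > 0" "\<And>b. b \<in> set bs \<Longrightarrow> c + b > 0" "z > 0"
  shows "(LINT t|lborel. gamma_prod c bs t * exp (- Complex c t * of_real (ln z)))
      = of_real (2 * pi * gamma_conv bs z)"
  using assms(2,3)
proof (induction bs arbitrary: z)
  case Nil
  then show ?case using Cahen_Mellin[OF assms(1)] by (simp add: gamma_prod_def)
next
  case (Cons b bs)
  show ?case
    by (rule gamma_conv_step(2)) (use Cons assms(1) in auto)
qed

lemma ex_greater_minus: "\<exists>c::real. c > 0 \<and> (\<forall>b\<in>set bs. c + b > 0)"
proof (induction bs)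
  case Nil
  then show ?case by (intro exI[of _ 1]) simp
next
  case (Cons b bs)
  then obtain c where "c > 0" "\<forall>b\<in>set bs. c + b > 0" by auto
  then show ?case by (intro exI[of _ "max c (1 - b)"]) (auto intro: less_le_trans)
qed

lemma integrable_gamma_conv:
  assumes "z > 0"
  shows "integrable lborel (\<lambda>x. indicator {0<..} x * (x powr (b - 1) * exp (- x)) * gamma_conv bs (z / x))"
proof -
  obtain c where "c > 0" "\<forall>b\<in>set (b # bs). c + b > 0" using ex_greater_minus[of "b # bs"] by blast
  then show ?thesis
    by (intro gamma_conv_step(1)[of c] integral_gamma_prod assms) auto
qed

text \<open>The inversion formula \<open>integral_gamma_prod\<close> holds on every vertical line to
  the right of the poles, so it does not matter which one \<open>SOME\<close> picks once such a line
  is known to exist.\<close>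

lemma meijer_G_eq_gamma_conv:
  assumes z: "z > 0"
  shows "meijer_G (0 # bs) z = gamma_conv bs z"
proof -
  define c where "c = (SOME c :: real. \<forall>b\<in>set (0 # bs). c > - b)"
  have "\<exists>c :: real. \<forall>b\<in>set (0 # bs). c > - b"
    using ex_greater_minus[of bs] by (force simp: algebra_simps)
  then have "\<forall>b\<in>set (0 # bs). c > - b" unfolding c_def by (rule someI_ex)
  then have c: "c > 0" "c + b > 0" if "b \<in> set bs" for b using that by force+
  have c0: "c > 0" using \<open>\<forall>b\<in>set (0 # bs). c > - b\<close> by simp
  have "(\<Prod>b\<leftarrow>0 # bs. Gamma (of_real b + Complex c t)) * of_real z powr (- Complex c t) * \<i>
     = \<i> * (gamma_prod c bs t * exp (- Complex c t * of_real (ln z)))" for t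
  proof -
    have "of_real b + Complex c t = Complex (c + b) t" for b by (simp add: complex_eq_iff)
    moreover have "of_real z powr (- Complex c t) = exp (- Complex c t * of_real (ln z))"
      using z by (subst powr_def) (simp add: Ln_of_real)
    ultimately show ?thesis by (simp add: gamma_prod_def)
  qed
  then have "mellin_barnes c (0 # bs) z = 1 / (2 * of_real pi * \<i>) * (\<i> * of_real (2 * pi * gamma_conv bs z))"
    unfolding mellin_barnes_def Let_def
    by (simp only: integral_mult_right_zero integral_gamma_prod[OF c0 c(2) z])
  also have "\<dots> = of_real (gamma_conv bs z)" by simp
  finally show ?thesis by (simp add: meijer_G_def c_def)
qed

section \<open>Moments of the iterated convolutions\<close>

definition exp_moment :: "'a::euclidean_space itself \<Rightarrow> nat \<Rightarrow> ennreal" where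
  "exp_moment _ k = (\<integral>\<^sup>+\<theta>. ennreal (norm (\<theta> :: 'a) ^ k * exp (- (norm \<theta>)\<^sup>2)) \<partial>lborel)"

lemma exp_moment_pos: "exp_moment TYPE('a::euclidean_space) k > 0"
proof -
  have "exp_moment TYPE('a) k \<noteq> 0"
  proof
    assume "exp_moment TYPE('a) k = 0"
    then have "AE \<theta> in (lborel :: 'a measure). ennreal (norm \<theta> ^ k * exp (- (norm \<theta>)\<^sup>2)) = 0"
      unfolding exp_moment_def by (subst (asm) nn_integral_0_iff_AE) auto
    moreover have "AE \<theta> in (lborel :: 'a measure). \<theta> \<noteq> 0" by (rule AE_lborel_singleton)
    ultimately have "AE \<theta> in (lborel :: 'a measure). False"
      by eventually_elim (auto simp: ennreal_eq_0_iff mult_le_0_iff power_le_zero_eq)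
    then show False
      by (simp add: AE_iff_null null_sets_def)
  qed
  then show ?thesis by (simp add: zero_less_iff_neq_zero)
qed

text \<open>Half of the exponent absorbs the power; the other half is the standard normal density up
  to a constant.\<close>

lemma exp_moment_finite: "exp_moment TYPE('a::euclidean_space) k < \<infinity>"
proof -
  define C where "C = fact k * exp (1 / 2) * sqrt ((2 * pi) ^ DIM('a))"
  have C: "C \<ge> 0" by (simp add: C_def)
  have "norm \<theta> ^ k * exp (- (norm \<theta>)\<^sup>2) \<le> C * gauss 1 \<theta>" for \<theta> :: 'a
  proof -
    have "norm \<theta> ^ k * exp (- (norm \<theta>)\<^sup>2 / 2) * exp (- (norm \<theta>)\<^sup>2 / 2) \<le> fact k * exp (1 / 2) * exp (- (norm \<theta>)\<^sup>2 / 2)"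
      by (intro mult_right_mono power_mult_exp_minus_square_le) auto
    then show ?thesis by (simp add: C_def gauss_def mult.assoc flip: exp_add)
  qed
  then have "exp_moment TYPE('a) k \<le> (\<integral>\<^sup>+\<theta>. ennreal C * ennreal (gauss 1 (\<theta> :: 'a)) \<partial>lborel)"
    unfolding exp_moment_def using C by (intro nn_integral_mono) (simp add: ennreal_mult'[symmetric] ennreal_leI)
  also have "\<dots> = ennreal C" by (simp add: nn_integral_cmult nn_integral_gauss)
  finally show ?thesis by (simp add: le_less_trans)
qed

text \<open>Rescaling by \<open>sqrt B\<close> multiplies volume and norm power together by
  \<open>B powr q\<close>. In the induction step Tonelli's theorem leads to the scale
  \<open>B * x\<close>, whose factor \<open>x powr q\<close> turns the integral over
  \<open>x\<close> into \<open>Gamma (b + q)\<close>; hence the induction over all scales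
  \<open>B\<close>.\<close>

lemma nn_integral_moment_gamma_conv:
  fixes k :: nat
  defines "q \<equiv> (real DIM('a::euclidean_space) + real k) / 2"
  assumes "B > 0" "\<And>b. b \<in> set bs \<Longrightarrow> b + q > 0"
  shows "(\<integral>\<^sup>+\<theta>. ennreal (norm (\<theta> :: 'a) ^ k * gamma_conv bs ((norm \<theta>)\<^sup>2 / B)) \<partial>lborel)
    = ennreal (B powr q * (\<Prod>b\<leftarrow>bs. Gamma (b + q))) * exp_moment TYPE('a) k"
  using assms(2,3)
proof (induction bs arbitrary: B)
  case Nil
  define s where "s = sqrt B"
  have s: "s > 0" "s\<^sup>2 = B" using Nil by (simp_all add: s_def)
  have "s ^ DIM('a) * s ^ k = B powr q"
  proof -
    have "s ^ DIM('a) * s ^ k = s powr real (DIM('a) + k)"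
      using s(1) by (simp only: powr_realpow power_add)
    also have "real (DIM('a) + k) = 2 * q" by (simp add: q_def)
    also have "s powr (2 * q) = (s powr 2) powr q" by (simp only: powr_powr)
    also have "s powr 2 = B" using s by simp
    finally show ?thesis .
  qed
  then have *: "s ^ DIM('a) * (norm (s *\<^sub>R \<theta>) ^ k * exp (- ((norm (s *\<^sub>R \<theta>))\<^sup>2 / B)))
     = B powr q * (norm \<theta> ^ k * exp (- (norm \<theta>)\<^sup>2))" for \<theta> :: 'a
    using s by (simp add: power_mult_distrib mult.assoc[symmetric])
  have "(\<integral>\<^sup>+\<theta>. ennreal (norm (\<theta> :: 'a) ^ k * exp (- ((norm \<theta>)\<^sup>2 / B))) \<partial>lborel)
     = (\<integral>\<^sup>+\<theta>. ennreal (s ^ DIM('a)) * ennreal (norm (s *\<^sub>R \<theta> :: 'a) ^ k * exp (- ((norm (s *\<^sub>R \<theta>))\<^sup>2 / B))) \<partial>lborel)"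
    using s by (subst nn_integral_lborel_scale[of _ s]) (auto simp: nn_integral_cmult)
  also have "\<dots> = (\<integral>\<^sup>+\<theta>. ennreal (B powr q) * ennreal (norm (\<theta> :: 'a) ^ k * exp (- (norm \<theta>)\<^sup>2)) \<partial>lborel)"
    using s by (simp only: ennreal_mult'[symmetric] * zero_le_power less_imp_le powr_ge_zero)
  also have "\<dots> = ennreal (B powr q) * exp_moment TYPE('a) k"
    by (simp add: nn_integral_cmult exp_moment_def)
  finally show ?case by simp
next
  case (Cons b bs)
  let ?w = "\<lambda>x :: real. indicator {0<..} x * (x powr (b - 1) * exp (- x)) :: real"
  let ?K = "(\<Prod>b\<leftarrow>bs. Gamma (b + q))"
  have K: "?K \<ge> 0" using Cons.prems by (intro prod_list_nonneg) (auto intro!: less_imp_le Gamma_real_pos)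
  have bq: "b + q > 0" using Cons.prems by simp
  \<comment> \<open>The origin is left out because \<open>integrable_gamma_conv\<close> requires a
    positive argument.\<close>
  have "AE \<theta> in (lborel :: 'a measure). ennreal (norm \<theta> ^ k * gamma_conv (b # bs) ((norm \<theta>)\<^sup>2 / B))
    = (\<integral>\<^sup>+x. ennreal (?w x * (norm \<theta> ^ k * gamma_conv bs ((norm \<theta>)\<^sup>2 / (B * x)))) \<partial>lborel)"
    using AE_lborel_singleton[of "0 :: 'a"]
  proof eventually_elim
    fix \<theta> :: 'a assume "\<theta> \<noteq> 0"
    then have "(norm \<theta>)\<^sup>2 / B > 0" using Cons.prems by simp
    from integrable_gamma_conv[OF this, of b bs]
    have "ennreal (gamma_conv (b # bs) ((norm \<theta>)\<^sup>2 / B)) = (\<integral>\<^sup>+x. ennreal (?w x * gamma_conv bs ((norm \<theta>)\<^sup>2 / B / x)) \<partial>lborel)"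
      unfolding gamma_conv.simps
      by (intro nn_integral_eq_integral[symmetric]) (auto simp: gamma_conv_nonneg)
    then have "ennreal (norm \<theta> ^ k) * ennreal (gamma_conv (b # bs) ((norm \<theta>)\<^sup>2 / B))
       = (\<integral>\<^sup>+x. ennreal (norm \<theta> ^ k) * ennreal (?w x * gamma_conv bs ((norm \<theta>)\<^sup>2 / B / x)) \<partial>lborel)"
      by (simp add: nn_integral_cmult)
    then show "ennreal (norm \<theta> ^ k * gamma_conv (b # bs) ((norm \<theta>)\<^sup>2 / B))
      = (\<integral>\<^sup>+x. ennreal (?w x * (norm \<theta> ^ k * gamma_conv bs ((norm \<theta>)\<^sup>2 / (B * x)))) \<partial>lborel)"
      by (simp add: ennreal_mult'[symmetric] mult_ac del: gamma_conv.simps)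
  qed
  then have "(\<integral>\<^sup>+\<theta>. ennreal (norm (\<theta> :: 'a) ^ k * gamma_conv (b # bs) ((norm \<theta>)\<^sup>2 / B)) \<partial>lborel)
    = (\<integral>\<^sup>+\<theta>. (\<integral>\<^sup>+x. ennreal (?w x * (norm (\<theta> :: 'a) ^ k * gamma_conv bs ((norm \<theta>)\<^sup>2 / (B * x)))) \<partial>lborel) \<partial>lborel)"
    by (rule nn_integral_cong_AE)
  also have "\<dots> = (\<integral>\<^sup>+x. (\<integral>\<^sup>+\<theta>. ennreal (?w x * (norm (\<theta> :: 'a) ^ k * gamma_conv bs ((norm \<theta>)\<^sup>2 / (B * x)))) \<partial>lborel) \<partial>lborel)"
    by (rule lborel_pair.Fubini'[symmetric]) measurable
  also have "\<dots> = (\<integral>\<^sup>+x. ennreal (indicator {0<..} x * x powr (b + q - 1) * exp (- x)) * (ennreal (B powr q * ?K) * exp_moment TYPE('a) k) \<partial>lborel)"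
  proof (intro nn_integral_cong)
    fix x :: real
    have w: "?w x \<ge> 0" by simp
    show "(\<integral>\<^sup>+\<theta>. ennreal (?w x * (norm (\<theta> :: 'a) ^ k * gamma_conv bs ((norm \<theta>)\<^sup>2 / (B * x)))) \<partial>lborel)
      = ennreal (indicator {0<..} x * x powr (b + q - 1) * exp (- x)) * (ennreal (B powr q * ?K) * exp_moment TYPE('a) k)"
    proof (cases "x > 0")
      case True
      have "(\<integral>\<^sup>+\<theta>. ennreal (?w x * (norm (\<theta> :: 'a) ^ k * gamma_conv bs ((norm \<theta>)\<^sup>2 / (B * x)))) \<partial>lborel)
        = ennreal (?w x) * (\<integral>\<^sup>+\<theta>. ennreal (norm (\<theta> :: 'a) ^ k * gamma_conv bs ((norm \<theta>)\<^sup>2 / (B * x))) \<partial>lborel)"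
        by (simp only: ennreal_mult'[OF w]) (subst nn_integral_cmult, auto)
      also have "\<dots> = ennreal (?w x) * (ennreal ((B * x) powr q * ?K) * exp_moment TYPE('a) k)"
        using Cons.IH[of "B * x"] Cons.prems True by simp
      also have "\<dots> = ennreal (?w x * ((B * x) powr q * ?K)) * exp_moment TYPE('a) k"
        by (subst ennreal_mult'[OF w]) (rule mult.assoc[symmetric])
      also have "?w x * ((B * x) powr q * ?K) = (indicator {0<..} x * x powr (b + q - 1) * exp (- x)) * (B powr q * ?K)"
      proof -
        have "x powr (b + q - 1) = x powr (b - 1) * x powr q"
          by (simp flip: powr_add) (simp add: algebra_simps)
        then show ?thesis using True Cons.prems by (simp add: powr_mult)
      qed
      also have "ennreal \<dots> = ennreal (indicator {0<..} x * x powr (b + q - 1) * exp (- x)) * ennreal (B powr q * ?K)"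
        by (rule ennreal_mult') simp
      finally show ?thesis by (simp only: mult.assoc)
    qed simp
  qed
  also have "\<dots> = (\<integral>\<^sup>+x. ennreal (indicator {0<..} x * x powr (b + q - 1) * exp (- x)) \<partial>lborel) * (ennreal (B powr q * ?K) * exp_moment TYPE('a) k)"
    by (rule nn_integral_multc) simp
  also have "(\<integral>\<^sup>+x. ennreal (indicator {0<..} x * x powr (b + q - 1) * exp (- x)) \<partial>lborel) = ennreal (Gamma (b + q))"
    using has_bochner_integral_gamma_kernel_real[OF bq]
    by (subst nn_integral_eq_integral) (auto simp: has_bochner_integral_iff)
  also have "ennreal (Gamma (b + q)) * (ennreal (B powr q * ?K) * exp_moment TYPE('a) k)
     = ennreal (B powr q * (\<Prod>b\<leftarrow>b # bs. Gamma (b + q))) * exp_moment TYPE('a) k"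
  proof -
    have "B powr q * (\<Prod>b\<leftarrow>b # bs. Gamma (b + q)) = Gamma (b + q) * (B powr q * ?K)" by simp
    then show ?thesis
      by (simp only: ennreal_mult'[OF less_imp_le[OF Gamma_real_pos[OF bq]]] mult.assoc)
  qed
  finally show ?case .
qed

section \<open>The network prior\<close>

text \<open>The exponent \<open>q\<close> grows with \<open>k\<close>, so the condition at order 0
  covers all orders; each moment is then a finite positive multiple of
  \<open>exp_moment\<close>.\<close>

lemma has_moments_gamma_conv:
  assumes B: "B > 0" and bs: "\<And>b. b \<in> set bs \<Longrightarrow> b + real DIM('a::euclidean_space) / 2 > 0"
  shows "integrable lborel (\<lambda>\<theta> :: 'a. norm \<theta> ^ k * gamma_conv bs ((norm \<theta>)\<^sup>2 / B))" (is "integrable _ ?f")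
    and "(LINT \<theta>|lborel. norm (\<theta> :: 'a) ^ k * gamma_conv bs ((norm \<theta>)\<^sup>2 / B)) > 0"
proof -
  define q where "q = (real DIM('a) + real k) / 2"
  have q: "b + q > 0" if "b \<in> set bs" for b
    using bs[OF that] by (simp add: q_def add_divide_distrib)
  define C where "C = B powr q * (\<Prod>b\<leftarrow>bs. Gamma (b + q))"
  have "(\<Prod>b\<leftarrow>bs. Gamma (b + q)) > 0"
    using q by (induction bs) (auto intro!: mult_pos_pos Gamma_real_pos)
  then have C: "C > 0" using B by (simp add: C_def)
  have *: "(\<integral>\<^sup>+\<theta>. ennreal (?f \<theta>) \<partial>lborel) = ennreal C * exp_moment TYPE('a) k"
    unfolding C_def q_def by (rule nn_integral_moment_gamma_conv[OF B q[unfolded q_def]])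
  then show int: "integrable lborel ?f"
    using exp_moment_finite[where 'a='a, of k]
    by (intro integrableI_nonneg) (auto simp: gamma_conv_nonneg ennreal_mult_less_top)
  have "ennreal (LINT \<theta>|lborel. ?f \<theta>) = ennreal C * exp_moment TYPE('a) k"
    unfolding *[symmetric] by (intro nn_integral_eq_integral[symmetric] int) (simp add: gamma_conv_nonneg)
  also have "\<dots> > 0"
    using C exp_moment_pos[where 'a='a, of k] by (simp add: ennreal_zero_less_mult_iff)
  finally show "(LINT \<theta>|lborel. ?f \<theta>) > 0" by simp
qed

lemma finite_moments_prior_gamma_mixture:
  fixes \<pi> :: "real^'p \<Rightarrow> real"
  assumes B: "B > 0" and K: "finite K" "K \<noteq> {}" and w: "\<And>k. k \<in> K \<Longrightarrow> w k > 0"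
    and bs: "\<And>k b. k \<in> K \<Longrightarrow> b \<in> set (bs k) \<Longrightarrow> b + real CARD('p) / 2 > 0"
    and \<pi>: "\<And>\<theta>. \<pi> \<theta> = (if \<theta> = 0 then 0 else \<Sum>k\<in>K. w k * gamma_conv (bs k) ((norm \<theta>)\<^sup>2 / B))"
  shows "finite_moments_prior \<pi>"
proof
  let ?g = "\<lambda>\<theta>. \<Sum>k\<in>K. w k * gamma_conv (bs k) ((norm (\<theta> :: real^'p))\<^sup>2 / B)"
  show meas [measurable]: "\<pi> \<in> borel_measurable borel"
    unfolding \<pi>[abs_def] by measurable
  show "\<pi> \<theta> \<ge> 0" for \<theta>
  proof -
    have "(\<Sum>k\<in>K. w k * gamma_conv (bs k) ((norm \<theta>)\<^sup>2 / B)) \<ge> 0"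
      by (rule sum_nonneg) (simp add: gamma_conv_nonneg w less_imp_le)
    then show ?thesis by (simp add: \<pi>)
  qed
  have int: "integrable lborel (\<lambda>\<theta> :: real^'p. norm \<theta> ^ j * gamma_conv (bs k) ((norm \<theta>)\<^sup>2 / B))"
    and pos: "(LINT \<theta>|lborel. norm (\<theta> :: real^'p) ^ j * gamma_conv (bs k) ((norm \<theta>)\<^sup>2 / B)) > 0" if "k \<in> K" for j k
    using has_moments_gamma_conv[where 'a="real^'p", OF B, of "bs k" j] bs[OF that] by simp_all
  have AE: "AE \<theta> in lborel. norm \<theta> ^ j * \<pi> \<theta> = (\<Sum>k\<in>K. w k * (norm \<theta> ^ j * gamma_conv (bs k) ((norm \<theta>)\<^sup>2 / B)))" for j
    using AE_lborel_singleton[of "0 :: real^'p"]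
    by eventually_elim (simp add: \<pi> sum_distrib_left mult_ac)
  show "integrable lborel (\<lambda>\<theta>. norm \<theta> ^ j * \<pi> \<theta>)" for j
    by (subst integrable_cong_AE[OF _ _ AE]) (auto intro!: Bochner_Integration.integrable_sum integrable_mult_right int)
  have "(LINT \<theta>|lborel. norm \<theta> ^ 0 * \<pi> \<theta>) =
     (LINT \<theta>|lborel. (\<Sum>k\<in>K. w k * (norm (\<theta> :: real^'p) ^ 0 * gamma_conv (bs k) ((norm \<theta>)\<^sup>2 / B))))"
    by (rule integral_cong_AE[OF _ _ AE]) measurable
  also have "\<dots> = (\<Sum>k\<in>K. (LINT \<theta>|lborel. w k * (norm (\<theta> :: real^'p) ^ 0 * gamma_conv (bs k) ((norm \<theta>)\<^sup>2 / B))))"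
    by (intro Bochner_Integration.integral_sum integrable_mult_right int)
  also have "\<dots> = (\<Sum>k\<in>K. w k * (LINT \<theta>|lborel. norm (\<theta> :: real^'p) ^ 0 * gamma_conv (bs k) ((norm \<theta>)\<^sup>2 / B)))"
    by (simp only: integral_mult_right_zero)
  also have "\<dots> > 0" using K w pos[of _ 0] by (intro sum_pos mult_pos_pos)
  finally show "(LINT \<theta>|lborel. \<pi> \<theta>) > 0" by simp
qed

lemma bnn_scale_pos:
  assumes "\<And>l. l \<in> {1..d} \<Longrightarrow> \<sigma> l > 0" "x \<noteq> 0"
  shows "bnn_scale d \<sigma> x > 0"
  unfolding bnn_scale_def using assms by (intro mult_pos_pos prod_pos) fastforce+

lemma finite_moments_prior_bnn_prior:
  fixes x :: "real^'m"
  assumes n: "\<And>l. l \<in> {1..d-1} \<Longrightarrow> n l \<ge> 1" and \<sigma>: "\<And>l. l \<in> {1..d} \<Longrightarrow> \<sigma> l > 0" and x: "x \<noteq> 0"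
  shows "finite_moments_prior (bnn_prior d n \<sigma> x :: real^'p \<Rightarrow> real)"
proof -
  let ?p = "real CARD('p)" and ?B = "bnn_scale d \<sigma> x" and ?K = "\<Pi>\<^sub>E l\<in>{1..d-1}. {1..n l}"
  define bs :: "(nat \<Rightarrow> nat) \<Rightarrow> real list" where "bs k = map (\<lambda>l. (real (k l) - ?p) / 2) [1..<d]" for k
  define w :: "(nat \<Rightarrow> nat) \<Rightarrow> real" where "w k = 1 / 2 ^ (\<Sum>l\<in>{1..d-1}. n l) * ((\<Prod>l\<in>{1..d-1}. real (n l choose k l)) *
          ((\<Prod>l\<in>{1..d-1}. inverse (Gamma (real (k l) / 2))) / (pi * ?B) powr (?p / 2)))" for k
  have B: "?B > 0" using bnn_scale_pos[of d \<sigma> x] \<sigma> x by blast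
  show ?thesis
  proof (rule finite_moments_prior_gamma_mixture[OF B, of ?K w bs])
    show "finite ?K" by (intro finite_PiE) auto
    \<comment> \<open>Every hidden width is at least 1, so each layer offers an index.\<close>
    show "?K \<noteq> {}" using n by (auto simp: PiE_eq_empty_iff)
    fix k assume k: "k \<in> ?K"
    have kl: "1 \<le> k l \<and> k l \<le> n l" if "l \<in> {1..d-1}" for l
      using PiE_mem[OF k that] by simp
    show "w k > 0"
      unfolding w_def using B kl
      by (intro mult_pos_pos divide_pos_pos prod_pos) (auto simp: Suc_le_eq intro!: Gamma_real_pos)
    \<comment> \<open>With \<open>b = (k l - ?p) / 2\<close> the sum equals \<open>k l / 2\<close>,
      which is positive because the indices start at 1, the inactive network being excluded.\<close>
    show "b + ?p / 2 > 0" if "b \<in> set (bs k)" for b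
      using that kl by (force simp: bs_def diff_divide_distrib)
  next
    fix \<theta> :: "real^'p"
    show "bnn_prior d n \<sigma> x \<theta> = (if \<theta> = 0 then 0 else \<Sum>k\<in>?K. w k * gamma_conv (bs k) ((norm \<theta>)\<^sup>2 / ?B))"
      using B by (simp add: bnn_prior_def Let_def meijer_G_eq_gamma_conv sum_distrib_left w_def bs_def mult.assoc)
  qed
qed

theorem theorem2p6:
  fixes d :: nat and n :: "nat \<Rightarrow> nat" and \<sigma> :: "nat \<Rightarrow> real" and x :: "real^'m"
  assumes "CARD('p::finite) \<ge> 3"
    and "d \<ge> 2"
    and "\<And>l. l \<in> {1..d-1} \<Longrightarrow> n l \<ge> 1"
    and "\<And>l. l \<in> {1..d} \<Longrightarrow> \<sigma> l > 0"
    and "x \<noteq> 0"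
  shows "\<not> minimax (delta_bnn_fixed d n \<sigma> x :: real^'p \<Rightarrow> real^'p)"
  unfolding delta_bnn_fixed_def
  by (intro finite_moments_prior.not_minimax_posterior_mean finite_moments_prior_bnn_prior assms(3-5))

end
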